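(* Let $K$ be a convex body in $\mathbb{R}^2$ whose John ellipsoid is a Euclidean ball, and let $\varepsilon\in[0,1)$. If $\delta_{\rm vol}(K,T^2)\ge \varepsilon$, then $$\frac{S(K)^2}{V(K)}\le (1-\gamma\varepsilon)\,\frac{S(T^2)^2}{V(T^2)},$$ where one may choose $\gamma=2^{-10}3^{-2}$.
   Context: A convex body is a compact convex set with non-empty interior; in the plane $V$ denotes area and $S$ denotes perimeter. $B^2$ is the Euclidean unit disc centred at the origin, and $T^2$ is a regular triangle circumscribed about $B^2$ (every edge is tangent to $B^2$, and $B^2\subset T^2$). The John ellipsoid of a convex body $K$ is the unique ellipsoid of maximal volume (area) contained in $K$. For convex bodies $K,M$ in $\mathbb{R}^2$, put $\alpha=V(K)^{-1/2}$, $\beta=V(M)^{-1/2}$ and $$\delta_{\rm vol}(K,M)=\min\{V(\Phi(\alpha K)\,\Delta\,(x+\beta M)):\ \Phi\in {\rm SL}(2),\ x\in\mathbb{R}^2\},$$ where $\Delta$ is the symmetric difference. *)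

theory Defs
  imports "HOL-Analysis.Analysis"
begin

definition convex_body :: "(real^2) set \<Rightarrow> bool" where
  "convex_body K \<longleftrightarrow> compact K \<and> convex K \<and> interior K \<noteq> {}"

abbreviation area :: "(real^2) set \<Rightarrow> real" where
  "area K \<equiv> measure lebesgue K"

text \<open>Length of a curve on the unit interval: the supremum of the lengths of its inscribed
  polygonal lines. The real-valued supremum is meaningful only for rectifiable curves, which
  covers all parametrizations of the boundary of a planar convex body.\<close>

definition curve_length :: "(real \<Rightarrow> real^2) \<Rightarrow> real" where
  "curve_length g =
     Sup {(\<Sum>i<n. dist (g (t i)) (g (t (Suc i)))) | n t.
            (\<forall>i\<le>n. t i \<in> {0..1}) \<and> (\<forall>i<n. t i \<le> t (Suc i))}"

definition closed_curve_onto :: "(real \<Rightarrow> real^2) \<Rightarrow> (real^2) set \<Rightarrow> bool" where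
  "closed_curve_onto g C \<longleftrightarrow>
     simple_path g \<and> pathfinish g = pathstart g \<and> path_image g = C"

text \<open>Length of the boundary, which for a planar convex body is a Jordan curve. The length does
  not depend on the choice of the simple closed parametrization.\<close>

definition perimeter :: "(real^2) set \<Rightarrow> real" where
  "perimeter K = curve_length (SOME g. closed_curve_onto g (frontier K))"

definition ellipsoid :: "(real^2) set \<Rightarrow> bool" where
  "ellipsoid E \<longleftrightarrow> (\<exists>(A::real^2^2) c. invertible A \<and> E = (\<lambda>x. c + A *v x) ` cball 0 1)"

text \<open>Ellipsoids are non-degenerate. By John's theorem a convex body has exactly one
  ellipsoid with this property.\<close>

definition is_john_ellipsoid :: "(real^2) set \<Rightarrow> (real^2) set \<Rightarrow> bool" where
  "is_john_ellipsoid E K \<longleftrightarrow> ellipsoid E \<and> E \<subseteq> K \<and>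
     (\<forall>E'. ellipsoid E' \<and> E' \<subseteq> K \<longrightarrow> area E' \<le> area E)"

text \<open>A segment contained in the boundary of a set containing the unit disc is tangent to the disc
  iff it meets the disc in exactly one point.\<close>

definition circumscribed_regular_triangle :: "(real^2) set \<Rightarrow> bool" where
  "circumscribed_regular_triangle T \<longleftrightarrow>
     (\<exists>a b c. a \<noteq> b \<and> dist a b = dist b c \<and> dist b c = dist c a \<and>
        T = convex hull {a, b, c} \<and> cball 0 1 \<subseteq> T \<and>
        (\<exists>p. closed_segment a b \<inter> cball 0 1 = {p}) \<and>
        (\<exists>p. closed_segment b c \<inter> cball 0 1 = {p}) \<and>
        (\<exists>p. closed_segment c a \<inter> cball 0 1 = {p}))"

text \<open>For convex bodies the infimum is attained, so it is the minimum.\<close>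

definition delta_vol :: "(real^2) set \<Rightarrow> (real^2) set \<Rightarrow> real" where
  "delta_vol K M =
     (let \<alpha> = area K powr (- 1 / 2); \<beta> = area M powr (- 1 / 2) in
      Inf {area (sym_diff ((\<lambda>y. \<Phi> *v y) ` ((\<lambda>y. \<alpha> *\<^sub>R y) ` K))
                          ((\<lambda>y. x + y) ` ((\<lambda>y. \<beta> *\<^sub>R y) ` M)))
           | (\<Phi> :: real^2^2) x. det \<Phi> = 1})"

end

theory Submission
  imports Defs
begin

text \<open>After a similarity the John ball of \<open>K\<close> is the unit disc. Joining the boundary to the centre splits
\<open>K\<close> into triangles of height at least 1, so \<open>S(K) \<le> 2 V(K)\<close> (\<open>inradius_perimeter_le\<close>) and hence
\<open>S(K)\<^sup>2 / V(K) \<le> 4 V(K)\<close>. For the regular circumscribed triangle the ratio is \<open>12 \<surd>3\<close>, which is 4 times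
its area \<open>3 \<surd>3\<close>. It is therefore enough to show that \<open>V(K)\<close> falls short of \<open>3 \<surd>3\<close> by a fixed
proportion of \<open>\<epsilon>\<close>, or, conversely, that a \<open>K\<close> of area close to \<open>3 \<surd>3\<close> is close to a triangle.

The maximality of the disc enters in one way only: every arc of length \<open>2\<pi>/3\<close> of the unit circle
contains a contact point with the boundary of \<open>K\<close> (\<open>john_contact_gap\<close>). If an arc did not, the disc could be
pushed towards it and stretched into an ellipse of larger area. From this, five contact points can be
selected whose consecutive angles \<open>2 h\<^sub>i\<close> are at most \<open>2\<pi>/3\<close> and add up to \<open>2\<pi>\<close>. The tangents there bound a
polygon that contains \<open>K\<close>, whence \<open>V(K) \<le> \<Sum> tan h\<^sub>i\<close> (\<open>area_le_sum_tan\<close>).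

As \<open>tan\<close> is convex on \<open>[0, \<pi>/3]\<close>, it lies below its chord, the more so the farther \<open>h\<close> is from both
endpoints (\<open>tan_deficit\<close>). Summing up gives \<open>V(K) \<le> 3 \<surd>3\<close>, and it shows that a small deficit
\<open>3 \<surd>3 - V(K)\<close> forces each \<open>h\<^sub>i\<close> to be close to \<open>0\<close> or to \<open>\<pi>/3\<close>. Three of the contact points are then nearly
equidistributed, and \<open>K\<close> lies in the triangle formed by their tangents, whose area is close to that of
\<open>K\<close> (\<open>john_disc_near_triangle\<close>). All triangles are affinely equivalent, so a triangle that contains
\<open>K\<close> and has almost the same area bounds \<open>\<delta>\<^sub>v\<^sub>o\<^sub>l(K, T)\<close> from above (\<open>delta_vol_le_triangle\<close>). The constant \<open>\<gamma>\<close>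
leaves ample room in these estimates.\<close>

section \<open>Triangles and areas in the plane\<close>

definition cross :: "real^2 \<Rightarrow> real^2 \<Rightarrow> real" where
  "cross p q = p $ 1 * q $ 2 - p $ 2 * q $ 1"

lemma inner_vec2: "(x::real^2) \<bullet> y = x $ 1 * y $ 1 + x $ 2 * y $ 2"
  by (simp add: inner_vec_def sum_2)

lemma norm_vec2_sq: "(norm (x::real^2))\<^sup>2 = (x $ 1)\<^sup>2 + (x $ 2)\<^sup>2"
  unfolding power2_norm_eq_inner inner_vec2 by (simp add: power2_eq_square)

lemma vec2_eq_iff: "(x::real^2) = y \<longleftrightarrow> x $ 1 = y $ 1 \<and> x $ 2 = y $ 2"
  by (simp add: vec_eq_iff forall_2)

lemma area_triangle:
  "area (convex hull {a, b, c}) = \<bar>cross (b - a) (c - a)\<bar> / 2"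
proof -
  have "compact (convex hull {a, b, c})" by (simp add: finite_imp_compact_convex_hull)
  then have "convex hull {a, b, c} \<in> sets borel" by (simp add: compact_imp_closed)
  then have "area (convex hull {a, b, c}) = measure lborel (convex hull {a, b, c})"
    by (simp add: measure_completion)
  then show ?thesis
    unfolding content_triangle cross_def by (simp add: algebra_simps abs_minus_commute)
qed

lemma lmeasurable_triangle: "convex hull {a, b, c :: real^2} \<in> lmeasurable"
  by (simp add: finite_imp_compact_convex_hull lmeasurable_compact)

lemma in_hull_zero2:
  fixes u w :: "real^2"
  assumes "0 \<le> \<mu>" "0 \<le> \<nu>" "\<mu> + \<nu> \<le> 1"
  shows "\<mu> *\<^sub>R u + \<nu> *\<^sub>R w \<in> convex hull {0, u, w}"
proof -
  have "\<mu> *\<^sub>R u + \<nu> *\<^sub>R w = (1 - \<mu> - \<nu>) *\<^sub>R 0 + \<mu> *\<^sub>R u + \<nu> *\<^sub>R w" by simp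
  moreover have "0 \<le> 1 - \<mu> - \<nu>" "1 - \<mu> - \<nu> + \<mu> + \<nu> = 1" using assms by auto
  ultimately show ?thesis unfolding convex_hull_3 using assms(1,2) by blast
qed

lemma hull_zero2E:
  fixes u w :: "real^2"
  assumes "x \<in> convex hull {0, u, w}"
  obtains \<mu> \<nu> where "0 \<le> \<mu>" "0 \<le> \<nu>" "\<mu> + \<nu> \<le> 1" "x = \<mu> *\<^sub>R u + \<nu> *\<^sub>R w"
  using assms unfolding convex_hull_3 by fastforce

lemma area_pos_iff:
  assumes "compact K" "convex K"
  shows "0 < area K \<longleftrightarrow> interior K \<noteq> {}"
proof -
  have "K \<in> lmeasurable" using assms(1) by (rule lmeasurable_compact)
  then have "area K = 0 \<longleftrightarrow> negligible K"
    by (simp add: negligible_iff_measure0)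
  then show ?thesis using negligible_convex_interior[OF assms(2)]
    by (metis measure_nonneg less_le)
qed

lemma area_matrix_image:
  fixes M :: "real^2^2"
  assumes "S \<in> lmeasurable"
  shows "area ((\<lambda>y. M *v y) ` S) = \<bar>det M\<bar> * area S"
  using measure_linear_image[OF matrix_vector_mul_linear assms, of M] by simp

lemma area_scale_image: "area ((\<lambda>y. s *\<^sub>R y) ` S) = s\<^sup>2 * area (S :: (real^2) set)"
  using measure_lebesgue_affine[of s 0 S] by simp

lemma area_affine_image: "area ((\<lambda>x. r *\<^sub>R x + c) ` S) = r\<^sup>2 * area (S :: (real^2) set)"
  using measure_lebesgue_affine[of r c S] by simp

section \<open>Perimeter and inradius\<close>

text \<open>Shrinking a point of \<open>K\<close> towards the interior point 0 leads into the interior.\<close>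

lemma frontier_scaleR_le:
  fixes K :: "(real^2) set"
  assumes "convex K" "0 \<in> interior K" "y \<in> K" "s *\<^sub>R y \<in> frontier K" "0 \<le> s"
  shows "1 \<le> s"
proof (rule ccontr)
  assume "\<not> 1 \<le> s"
  then have "y - (1 - s) *\<^sub>R (y - 0) \<in> interior K"
    using assms by (intro mem_interior_convex_shrink) auto
  moreover have "y - (1 - s) *\<^sub>R (y - 0) = s *\<^sub>R y" by (simp add: algebra_simps)
  ultimately show False using assms(4) by (simp add: frontier_def)
qed

lemma frontier_ray_unique:
  fixes K :: "(real^2) set"
  assumes K: "convex K" "closed K" "0 \<in> interior K" and p: "p \<in> frontier K" and q: "q \<in> frontier K"
    and eq: "s *\<^sub>R p = t *\<^sub>R q" and pos: "0 < s" "0 < t"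
  shows "p = q"
proof -
  have sub: "p \<in> K" "q \<in> K" using p q K(2) frontier_subset_closed by auto
  have *: "p = (t / s) *\<^sub>R q" "q = (s / t) *\<^sub>R p" 
    using eq pos by (auto simp: vector_fraction_eq_iff eq_vector_fraction_iff)
  have "1 \<le> t / s" "1 \<le> s / t"
    using frontier_scaleR_le[OF K(1,3)] sub * p q pos
    by (metis divide_nonneg_pos less_eq_real_def)+
  then have "s = t" using pos by (simp add: field_simps)
  then show ?thesis using eq pos by simp
qed

text \<open>The number \<open>\<bar>cross p q\<bar> / dist p q\<close> is the distance from 0 to the line through \<open>p\<close> and \<open>q\<close>. If it were
less than \<open>c\<close>, the point \<open>m\<close> of the line nearest to 0 would be interior to \<open>K\<close>. When \<open>m\<close> is outside the
segment, the endpoint next to \<open>m\<close> lies between \<open>m\<close> and the other endpoint, and so it is interior as well.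
When \<open>m\<close> is inside the segment, the chord is too long, as both endpoints lie outside the open ball of
radius \<open>r\<close>.\<close>

lemma chord_cross_ge:
  fixes K :: "(real^2) set"
  assumes K: "convex K" "closed K" "cball 0 r \<subseteq> K" and p: "p \<in> frontier K" and q: "q \<in> frontier K"
    and c: "0 \<le> c" "c < r" and near: "(dist p q)\<^sup>2 \<le> r\<^sup>2 - c\<^sup>2"
  shows "c * dist p q \<le> \<bar>cross p q\<bar>"
proof (cases "p = q")
  case True then show ?thesis by simp
next
  case False
  define e where "e = q - p"
  define E where "E = (norm e)\<^sup>2"
  have E: "E > 0" using False by (simp add: E_def e_def)
  have dpq: "dist p q = norm e" by (simp add: e_def dist_norm norm_minus_commute)
  show ?thesis
  proof (rule ccontr)
    assume neg: "\<not> ?thesis"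
    have "\<bar>cross p q\<bar>\<^sup>2 < (c * dist p q)\<^sup>2"
      using neg by (intro power_strict_mono) auto
    then have cr: "(cross p q)\<^sup>2 < c\<^sup>2 * E" by (simp add: dpq E_def power_mult_distrib)
    define t where "t = - (p \<bullet> e) / E"
    define m where "m = p + t *\<^sub>R e"
    have Ecomp: "E = (e $ 1)\<^sup>2 + (e $ 2)\<^sup>2" by (simp add: E_def norm_vec2_sq)
    have tE: "t * E = - (p $ 1 * e $ 1 + p $ 2 * e $ 2)" using E by (simp add: t_def inner_vec2)
    have mE: "(norm m)\<^sup>2 * E = (cross p q)\<^sup>2"
    proof -
      have "(norm m)\<^sup>2 * E = (norm p)\<^sup>2 * E + 2 * (t * E) * (p $ 1 * e $ 1 + p $ 2 * e $ 2) + (t * E)\<^sup>2"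
        unfolding norm_vec2_sq m_def Ecomp by (simp add: power2_eq_square algebra_simps)
      also have "\<dots> = (cross p q)\<^sup>2"
        unfolding tE unfolding norm_vec2_sq Ecomp cross_def e_def by (simp add: power2_eq_square algebra_simps)
      finally show ?thesis .
    qed
    have mc: "(norm m)\<^sup>2 < c\<^sup>2"
    proof -
      have "(norm m)\<^sup>2 * E < c\<^sup>2 * E" using mE cr by simp
      then show ?thesis using E by simp
    qed
    then have "norm m < r" using c by (meson less_trans power2_less_imp_less)
    then have mint: "m \<in> interior K"
      using K(3) interior_mono[of "cball 0 r" K] by (auto simp: interior_cball)
    have pK: "p \<in> K" "q \<in> K" using p q K(2) frontier_subset_closed by auto
    have pn: "p \<notin> interior K" "q \<notin> interior K" using p q by (auto simp: frontier_def)
    have seg: "x - u *\<^sub>R (x - m) \<in> interior K" if "x \<in> K" "0 < u" "u \<le> 1" for x u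
      using mem_interior_convex_shrink[OF K(1) mint] that by auto
    consider "t \<le> 0" | "1 \<le> t" | "0 < t" "t < 1" by linarith
    then show False
    proof cases
      case 1
      \<comment> \<open>\<open>p\<close> lies between \<open>m\<close> and \<open>q\<close>\<close>
      have "q - m = (1 - t) *\<^sub>R e" by (simp add: m_def e_def algebra_simps)
      then have "p = q - (1 / (1 - t)) *\<^sub>R (q - m)"
        using 1 by (simp add: e_def)
      then show False using seg[OF pK(2), of "1 / (1 - t)"] 1 pn by auto
    next
      case 2
      \<comment> \<open>\<open>q\<close> lies between \<open>m\<close> and \<open>p\<close>\<close>
      have "q = p - (1 / t) *\<^sub>R (p - m)"
        using 2 by (simp add: m_def e_def vec2_eq_iff field_simps)
      then show False using seg[OF pK(1), of "1 / t"] 2 pn by auto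
    next
      case 3
      have pr: "r \<le> norm p" 
      proof (rule ccontr)
        assume "\<not> r \<le> norm p"
        then have "p \<in> ball 0 r" by simp
        then show False using pn(1) K(3) interior_mono[of "cball 0 r" K] by (auto simp: interior_cball)
      qed
      have "(norm p)\<^sup>2 = (norm m)\<^sup>2 + t\<^sup>2 * E"
      proof -
        have "(norm m)\<^sup>2 = (norm p)\<^sup>2 + 2 * t * (p $ 1 * e $ 1 + p $ 2 * e $ 2) + t * (t * E)"
          unfolding norm_vec2_sq m_def Ecomp by (simp add: power2_eq_square algebra_simps)
        also have "\<dots> = (norm p)\<^sup>2 - t * (t * E)" unfolding tE by (simp add: algebra_simps)
        finally show ?thesis by (simp add: power2_eq_square)
      qed
      moreover have "r\<^sup>2 \<le> (norm p)\<^sup>2" using pr c by (intro power_mono) auto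
      moreover have "t\<^sup>2 * E \<le> 1 * E" using 3 E by (intro mult_right_mono) (auto simp: power_le_one)
      moreover have "E \<le> r\<^sup>2 - c\<^sup>2" using near by (simp add: dpq E_def)
      ultimately show False using mc by linarith
    qed
  qed
qed

definition cone_over :: "(real \<Rightarrow> real^2) \<Rightarrow> real \<Rightarrow> real \<Rightarrow> (real^2) set" where
  "cone_over g s u = (\<lambda>(l, t). l *\<^sub>R g t) ` ({0..1} \<times> {s..u})"

lemma cone_overE:
  assumes "y \<in> cone_over g s u"
  obtains l t where "y = l *\<^sub>R g t" "l \<in> {0..1}" "t \<in> {s..u}"
  using assms unfolding cone_over_def by auto

lemma compact_cone_over:
  assumes "path g" "0 \<le> s" "u \<le> 1"
  shows "compact (cone_over g s u)"
proof -
  have "continuous_on {s..u} g"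
    using assms unfolding path_def by (elim continuous_on_subset) auto
  then have "continuous_on ({0..1} \<times> {s..u}) (\<lambda>z. g (snd z))"
    by (rule continuous_on_compose2) (auto intro: continuous_intros)
  then show ?thesis unfolding cone_over_def case_prod_unfold
    by (intro compact_continuous_image continuous_intros compact_Times compact_Icc)
qed

text \<open>For \<open>y\<close> in the triangle, \<open>cross y (g t)\<close> has opposite signs at the ends of the arc. Hence the arc
meets the line through 0 and \<open>y\<close>. The half-plane condition makes sure that it meets the ray through \<open>y\<close>, and not the
opposite ray, which it would meet if it ran around 0 on the other side.\<close>

lemma triangle_subset_cone_over:
  assumes K: "convex K" "closed K" "0 \<in> interior K" and g: "path g" "path_image g \<subseteq> frontier K"
    and su: "0 \<le> s" "s \<le> u" "u \<le> 1" and half: "\<And>t. t \<in> {s..u} \<Longrightarrow> 0 < g t \<bullet> n"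
  shows "convex hull {0, g s, g u} \<subseteq> cone_over g s u"
proof
  fix y assume "y \<in> convex hull {0, g s, g u}"
  then obtain \<mu> \<nu> where mn: "0 \<le> \<mu>" "0 \<le> \<nu>" "\<mu> + \<nu> \<le> 1" and y: "y = \<mu> *\<^sub>R g s + \<nu> *\<^sub>R g u"
    by (rule hull_zero2E)
  have gK: "g t \<in> frontier K" "g t \<in> K" if "t \<in> {s..u}" for t
    using that su g(2) K(2) frontier_subset_closed by (force simp: path_image_def)+
  have cont: "continuous_on {s..u} g"
    using g(1) su unfolding path_def by (elim continuous_on_subset) auto
  show "y \<in> cone_over g s u"
  proof (cases "\<mu> + \<nu> = 0")
    case True
    then have "\<mu> = 0" "\<nu> = 0" using mn by auto
    then have "y = 0" by (simp add: y)
    then show ?thesis using su unfolding cone_over_def by (auto intro!: image_eqI[of _ _ "(0, s)"])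
  next
    case False
    have yn: "0 < y \<bullet> n"
    proof -
      have "0 < g s \<bullet> n" "0 < g u \<bullet> n" using half su by auto
      moreover have "0 < \<mu> \<or> 0 < \<nu>" using False mn by linarith
      ultimately show ?thesis using mn unfolding y
        by (auto simp: inner_add_left intro: add_pos_nonneg add_nonneg_pos)
    qed
    define f where "f t = cross y (g t)" for t
    have contf: "continuous_on {s..u} f" unfolding f_def cross_def
      by (intro continuous_intros cont)
    have fs: "f s = - \<nu> * cross (g s) (g u)" "f u = \<mu> * cross (g s) (g u)"
      by (simp_all add: f_def cross_def y algebra_simps)
    obtain t where t: "t \<in> {s..u}" "f t = 0"
    proof (cases "0 \<le> cross (g s) (g u)")
      case True
      then have "f s \<le> 0" "0 \<le> f u" using fs mn by (auto simp: mult_nonneg_nonneg)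
      then show ?thesis using IVT'[of f s 0 u] su contf that by auto
    next
      case False
      then have "0 \<le> f s" "f u \<le> 0" using fs mn by (auto simp: mult_nonneg_nonpos mult_nonneg_nonneg)
      then show ?thesis using IVT2'[of f u 0 s] su contf that by auto
    qed
    define l where "l = (y \<bullet> n) / (g t \<bullet> n)"
    have gn: "0 < g t \<bullet> n" using half t by auto
    have l0: "0 < l" using yn gn by (simp add: l_def)
    have lg: "y = l *\<^sub>R g t"
    proof -
      have "(g t \<bullet> n) *\<^sub>R y = (y \<bullet> n) *\<^sub>R g t"
        using t(2) unfolding f_def cross_def vec2_eq_iff inner_vec2 by (simp, algebra)
      then show ?thesis using gn unfolding l_def by (simp add: eq_vector_fraction_iff)
    qed
    have yK: "y \<in> K"
    proof -
      have "{0, g s, g u} \<subseteq> K" using gK su K(3) interior_subset by auto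
      then show ?thesis using \<open>y \<in> convex hull {0, g s, g u}\<close> K(1) hull_minimal by blast
    qed
    have "g t = (1 / l) *\<^sub>R y" using lg l0 by simp
    then have "1 \<le> 1 / l" using frontier_scaleR_le[OF K(1,3) yK, of "1 / l"] gK(1)[OF t(1)] l0 by auto
    then have "l \<le> 1" using l0 by simp
    then show ?thesis using lg l0 t(1) unfolding cone_over_def
      by (auto intro!: image_eqI[of _ _ "(l, t)"])
  qed
qed

lemma area_segment: "area (closed_segment a b) = 0"
  by (intro negligible_imp_measure0)
     (simp add: negligible_convex_interior interior_closed_segment_ge2)

text \<open>Every ray from 0 meets the frontier once and the curve is simple, so that the two cones overlap only in the
segment to \<open>g m\<close> and, if the arcs make up the whole closed curve, in the segment to \<open>g 0 = g 1\<close>.\<close>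

lemma area_cone_over_add:
  assumes K: "convex K" "closed K" "0 \<in> interior K" and g: "simple_path g" "path_image g \<subseteq> frontier K"
    and smu: "0 \<le> s" "s \<le> m" "m \<le> u" "u \<le> 1"
  shows "area (cone_over g s m) + area (cone_over g m u) = area (cone_over g s u)"
proof -
  have path: "path g" using g(1) by (simp add: simple_path_def)
  have un: "cone_over g s u = cone_over g s m \<union> cone_over g m u"
  proof -
    have "{s..u} = {s..m} \<union> {m..u}" using smu by auto
    then have "{0..1::real} \<times> {s..u} = {0..1} \<times> {s..m} \<union> {0..1} \<times> {m..u}" by auto
    then show ?thesis unfolding cone_over_def by (simp add: image_Un)
  qed
  have meas: "cone_over g s m \<in> lmeasurable" "cone_over g m u \<in> lmeasurable"
    using smu by (auto intro!: lmeasurable_compact compact_cone_over path)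
  have int: "cone_over g s m \<inter> cone_over g m u \<subseteq> closed_segment 0 (g m) \<union> closed_segment 0 (g 0)"
  proof
    fix y assume "y \<in> cone_over g s m \<inter> cone_over g m u"
    then have "y \<in> cone_over g s m" "y \<in> cone_over g m u" by auto
    then obtain l t l' t' where y: "y = l *\<^sub>R g t" "y = l' *\<^sub>R g t'"
      and l: "l \<in> {0..1}" "l' \<in> {0..1}" and t: "t \<in> {s..m}" "t' \<in> {m..u}"
      by (metis cone_overE)
    have seg: "l *\<^sub>R x \<in> closed_segment 0 x" if "l \<in> {0..1}" for l and x :: "real^2"
      using that by (auto simp: closed_segment_def)
    show "y \<in> closed_segment 0 (g m) \<union> closed_segment 0 (g 0)"
    proof (cases "y = 0")
      case True then show ?thesis by simp
    next
      case False
      then have "0 < l" "0 < l'" using y l by (auto simp: less_le)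
      moreover have "g t \<in> frontier K" "g t' \<in> frontier K"
        using t smu g(2) by (auto simp: path_image_def)
      ultimately have "g t = g t'" using frontier_ray_unique[OF K] y by metis
      then have "t = t' \<or> t = 0 \<and> t' = 1 \<or> t = 1 \<and> t' = 0"
        using g(1) t smu unfolding simple_path_def loop_free_def by auto
      then have "t = m \<or> t = 0" using t smu by auto
      then show ?thesis using y seg[OF l(1)] seg[OF l(2)] by auto
    qed
  qed
  have "negligible (closed_segment 0 (g m) \<union> closed_segment 0 (g 0))"
    by (intro negligible_Un) (simp_all add: negligible_convex_interior interior_closed_segment_ge2)
  then have "area (cone_over g s m \<inter> cone_over g m u) = 0"
    using int by (meson negligible_imp_measure0 negligible_subset)
  then show ?thesis using measure_Un3[OF meas] un by simp
qed

text \<open>The left side is subadditive and the right side additive under subdivision of the interval. It is therefore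
enough to prove the inequality for arbitrarily short arcs. There the chord satisfies the hypothesis of
\<open>chord_cross_ge\<close> for any given \<open>c < r\<close>; finally \<open>c\<close> tends to \<open>r\<close>.\<close>

lemma dist_le_area_cone_over:
  assumes K: "convex K" "closed K" "cball 0 r \<subseteq> K" "0 < r"
    and g: "simple_path g" "path_image g \<subseteq> frontier K"
    and su: "0 \<le> s" "s \<le> u" "u \<le> 1"
  shows "r * dist (g s) (g u) \<le> 2 * area (cone_over g s u)"
proof -
  have path: "path g" using g(1) by (simp add: simple_path_def)
  have int: "0 \<in> interior K"
    using K(3,4) interior_mono[of "cball 0 r" K] by (auto simp: interior_cball)
  have gf: "g t \<in> frontier K" if "t \<in> {0..1}" for t using that g(2) by (auto simp: path_image_def)
  have main: "c * dist (g s) (g u) \<le> 2 * area (cone_over g s u)" if c: "0 \<le> c" "c < r" for c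
  proof -
    define P where "P a b \<longleftrightarrow> (0 \<le> a \<and> a \<le> b \<and> b \<le> 1 \<longrightarrow> c * dist (g a) (g b) \<le> 2 * area (cone_over g a b))" for a b
    have "P s u"
      using su(2)
    proof (induction rule: Bolzano)
      case (trans a b d)
      show ?case
      proof (clarsimp simp: P_def)
        assume *: "0 \<le> a" "a \<le> d" "d \<le> 1"
        have "c * dist (g a) (g d) \<le> c * (dist (g a) (g b) + dist (g b) (g d))"
          using c(1) by (intro mult_left_mono dist_triangle)
        also have "\<dots> \<le> 2 * (area (cone_over g a b) + area (cone_over g b d))"
          using trans * by (auto simp: P_def algebra_simps)
        also have "\<dots> = 2 * area (cone_over g a d)"
          using area_cone_over_add[OF K(1,2) int g, of a b d] trans(3,4) * by simp
        finally show "c * dist (g a) (g d) \<le> 2 * area (cone_over g a d)" .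
      qed
    next
      case (local x)
      have x01: "x \<in> {0..1}" using local su by auto
      have "0 \<notin> frontier K" using int by (simp add: frontier_def)
      then have gx: "g x \<noteq> 0" using gf[OF x01] by auto
      \<comment> \<open>The first bound makes the chord short enough for \<open>chord_cross_ge\<close>, the second keeps the arc in a
        half-plane.\<close>
      define \<eta> where "\<eta> = min (sqrt (r\<^sup>2 - c\<^sup>2) / 2) (norm (g x))"
      have rc: "0 < r\<^sup>2 - c\<^sup>2" using c by (simp add: power_strict_mono)
      then have "0 < \<eta>" using gx by (simp add: \<eta>_def)
      moreover have "continuous_on {0..1} g" using path by (simp add: path_def)
      ultimately obtain d where d: "d > 0" "\<And>t. t \<in> {0..1} \<Longrightarrow> dist t x < d \<Longrightarrow> dist (g t) (g x) < \<eta>"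
        using x01 unfolding continuous_on_iff by metis
      show ?case
      proof (intro exI[of _ d] conjI d(1) allI impI)
        fix a b assume ab: "a \<le> x \<and> x \<le> b \<and> b - a < d"
        show "P a b"
        proof (clarsimp simp: P_def)
          assume *: "0 \<le> a" "a \<le> b" "b \<le> 1"
          have near: "dist (g t) (g x) < \<eta>" if "t \<in> {a..b}" for t
            using that ab * by (intro d(2)) (auto simp: dist_real_def)
          have half: "0 < g t \<bullet> g x" if "t \<in> {a..b}" for t
          proof -
            have "(g x - g t) \<bullet> g x \<le> norm (g x - g t) * norm (g x)" by (rule norm_cauchy_schwarz)
            also have "\<dots> < norm (g x) * norm (g x)"
              using near[OF that] gx by (intro mult_strict_right_mono) (auto simp: \<eta>_def dist_norm norm_minus_commute)
            finally show ?thesis by (simp add: inner_diff_left norm_eq_sqrt_inner)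
          qed
          have sub: "convex hull {0, g a, g b} \<subseteq> cone_over g a b"
            by (rule triangle_subset_cone_over[OF K(1,2) int path g(2) * half])
          have "dist (g a) (g b) \<le> dist (g a) (g x) + dist (g b) (g x)" by (rule dist_triangle2)
          also have "\<dots> \<le> sqrt (r\<^sup>2 - c\<^sup>2)" using near[of a] near[of b] * by (auto simp: \<eta>_def)
          finally have "(dist (g a) (g b))\<^sup>2 \<le> (sqrt (r\<^sup>2 - c\<^sup>2))\<^sup>2" by (intro power_mono) auto
          then have "c * dist (g a) (g b) \<le> \<bar>cross (g a) (g b)\<bar>"
            using rc * by (intro chord_cross_ge[OF K(1-3) _ _ c] gf) auto
          also have "\<dots> = 2 * area (convex hull {0, g a, g b})" by (simp add: area_triangle)
          also have "\<dots> \<le> 2 * area (cone_over g a b)"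
            using sub * lmeasurable_triangle
            by (auto intro!: measure_mono_fmeasurable lmeasurable_compact compact_cone_over path 
               simp: fmeasurableD)
          finally show "c * dist (g a) (g b) \<le> 2 * area (cone_over g a b)" .
        qed
      qed
    qed
    then show ?thesis using su by (simp add: P_def)
  qed
  show ?thesis
  proof (rule field_le_mult_one_interval)
    fix z :: real assume z: "0 < z" "z < 1"
    have "(z * r) * dist (g s) (g u) \<le> 2 * area (cone_over g s u)"
      using z K(4) by (intro main) auto
    then show "z * (r * dist (g s) (g u)) \<le> 2 * area (cone_over g s u)" by (simp add: mult.assoc)
  qed
qed

lemma inscribed_length_le_zero:
  assumes K: "convex K" "compact K" "cball 0 r \<subseteq> K" "0 < r"
    and g: "simple_path g" "path_image g \<subseteq> frontier K"
    and t: "\<forall>i\<le>n. t i \<in> {0..1}" "\<forall>i<n. t i \<le> t (Suc i)"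
  shows "r * (\<Sum>i<n. dist (g (t i)) (g (t (Suc i)))) \<le> 2 * area K"
proof -
  have cl: "closed K" using K(2) by (rule compact_imp_closed)
  have path: "path g" using g(1) by (simp add: simple_path_def)
  have int: "0 \<in> interior K"
    using K(3,4) interior_mono[of "cball 0 r" K] by (auto simp: interior_cball)
  have "t 0 \<le> t k \<and> r * (\<Sum>i<k. dist (g (t i)) (g (t (Suc i)))) \<le> 2 * area (cone_over g (t 0) (t k))"
    if "k \<le> n" for k
    using that
  proof (induction k)
    case (Suc k)
    then have IH: "t 0 \<le> t k" "r * (\<Sum>i<k. dist (g (t i)) (g (t (Suc i)))) \<le> 2 * area (cone_over g (t 0) (t k))"
      by auto
    have k: "t k \<le> t (Suc k)" "t (Suc k) \<le> 1" "0 \<le> t 0" using t Suc(2) by auto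
    have "r * dist (g (t k)) (g (t (Suc k))) \<le> 2 * area (cone_over g (t k) (t (Suc k)))"
      using k IH by (intro dist_le_area_cone_over[OF K(1) cl K(3,4) g]) auto
    then show ?case using IH area_cone_over_add[OF K(1) cl int g k(3) IH(1) k(1,2)] k
      by (auto simp: distrib_left)
  qed simp
  then have "r * (\<Sum>i<n. dist (g (t i)) (g (t (Suc i)))) \<le> 2 * area (cone_over g (t 0) (t n))" by simp
  also have "area (cone_over g (t 0) (t n)) \<le> area K"
  proof (rule measure_mono_fmeasurable)
    show "cone_over g (t 0) (t n) \<subseteq> K"
    proof
      fix y assume "y \<in> cone_over g (t 0) (t n)"
      then obtain l v where y: "y = l *\<^sub>R g v" "l \<in> {0..1}" "v \<in> {t 0..t n}" unfolding cone_over_def by auto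
      have "g v \<in> K" using y(3) t g(2) cl frontier_subset_closed by (force simp: path_image_def)
      moreover have "0 \<in> K" using int interior_subset by auto
      ultimately have "(1 - l) *\<^sub>R 0 + l *\<^sub>R g v \<in> K" using y(2) K(1) by (intro convexD_alt) auto
      then show "y \<in> K" by (simp add: y)
    qed
    show "cone_over g (t 0) (t n) \<in> sets lebesgue"
      using t by (intro fmeasurableD lmeasurable_compact compact_cone_over path) auto
  qed (use K(2) lmeasurable_compact in auto)
  finally show ?thesis by simp
qed

lemma inscribed_length_le:
  assumes K: "convex_body K" "cball c r \<subseteq> K" "0 < r" and g: "closed_curve_onto g (frontier K)"
    and t: "\<forall>i\<le>n. t i \<in> {0..1}" "\<forall>i<n. t i \<le> t (Suc i)"
  shows "(\<Sum>i<n. dist (g (t i)) (g (t (Suc i)))) \<le> 2 * area K / r"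
proof -
  define K' where "K' = (+) (- c) ` K"
  define g' where "g' = (\<lambda>x. - c + x) \<circ> g"
  have "convex K'" "compact K'" using K(1) unfolding K'_def convex_body_def
    by (blast intro: convex_translation compact_translation)+
  moreover have "cball 0 r \<subseteq> K'"
  proof
    fix x :: "real^2" assume "x \<in> cball 0 r"
    then have "c + x \<in> K" using K(2) by (intro subsetD[OF K(2)]) (simp add: dist_norm)
    then show "x \<in> K'" unfolding K'_def by (auto intro!: image_eqI[of _ _ "c + x"])
  qed
  moreover have "simple_path g'" unfolding g'_def simple_path_translation_eq
    using g by (simp add: closed_curve_onto_def)
  moreover have "path_image g' \<subseteq> frontier K'"
    using g unfolding g'_def K'_def closed_curve_onto_def frontier_translation path_image_translation by simp
  ultimately have "r * (\<Sum>i<n. dist (g' (t i)) (g' (t (Suc i)))) \<le> 2 * area K'"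
    using inscribed_length_le_zero[of K' r g' n t] K(3) t by blast
  moreover have "area K' = area K" unfolding K'_def by (rule measure_translation)
  moreover have "dist (g' x) (g' y) = dist (g x) (g y)" for x y by (simp add: g'_def dist_norm)
  ultimately show ?thesis using K(3) by (simp add: field_simps)
qed

text \<open>The perimeter is the length of a parametrization obtained by choice, and this lemma gives it a meaning: the
frontier is homeomorphic to the unit circle of the complex plane.\<close>

lemma closed_curve_onto_frontier_exists:
  assumes "convex_body K"
  shows "\<exists>g. closed_curve_onto g (frontier K)"
proof -
  have K: "convex K" "bounded K" "interior K \<noteq> {}"
    using assms by (auto simp: convex_body_def compact_imp_bounded)
  have "rel_frontier (cball 0 1 :: complex set) homeomorphic rel_frontier K"
    using K by (intro homeomorphic_rel_frontiers_convex_bounded_sets)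
      (auto simp: aff_dim_nonempty_interior aff_dim_cball)
  then have "sphere (0::complex) 1 homeomorphic frontier K"
    using K(3) by (simp add: rel_frontier_nonempty_interior)
  then obtain h k where hom: "homeomorphism (sphere (0::complex) 1) (frontier K) h k"
    unfolding homeomorphic_def by blast
  define e where "e t = cis (2 * pi * t)" for t
  have pe: "path e" unfolding path_def e_def by (intro continuous_intros)
  have lf: "loop_free e"
    unfolding loop_free_def
  proof (intro ballI impI)
    fix x y :: real assume xy: "x \<in> {0..1}" "y \<in> {0..1}" "e x = e y"
    then have "sin (2 * pi * x) = sin (2 * pi * y)" "cos (2 * pi * x) = cos (2 * pi * y)"
      by (auto simp: e_def complex_eq_iff)
    then obtain m :: int where "2 * pi * x = 2 * pi * y + 2 * pi * of_int m"
      using sin_cos_eq_iff[of "2 * pi * x" "2 * pi * y"] by (auto simp: algebra_simps)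
    then have "2 * pi * x = 2 * pi * (y + of_int m)" by (simp add: algebra_simps)
    then have "x = y + of_int m" by simp
    then show "x = y \<or> x = 0 \<and> y = 1 \<or> x = 1 \<and> y = 0"
    proof -
      assume a: "x = y + of_int m"
      then have "real_of_int m \<le> 1" "-1 \<le> real_of_int m" using xy by auto
      then have "m \<le> 1" "-1 \<le> m" by linarith+
      then have "m = 0 \<or> m = 1 \<or> m = -1" by presburger
      then show ?thesis using a xy by auto
    qed
  qed
  have pim: "path_image e = sphere 0 1"
  proof
    show "path_image e \<subseteq> sphere 0 1" by (auto simp: path_image_def e_def)
    show "sphere 0 1 \<subseteq> path_image e"
    proof
      fix z :: complex assume "z \<in> sphere 0 1"
      then have "z = cis (Arg2pi z)" using Arg2pi_eq[of z] by (simp add: cis_conv_exp)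
      moreover have "Arg2pi z / (2 * pi) \<in> {0..1}" using Arg2pi_ge_0[of z] Arg2pi_lt_2pi[of z] by simp
      ultimately show "z \<in> path_image e" unfolding path_image_def e_def
        by (intro image_eqI[of _ _ "Arg2pi z / (2 * pi)"]) auto
    qed
  qed
  have "simple_path (h \<circ> e)"
    using pe lf hom pim unfolding homeomorphism_def
    by (intro simple_path_continuous_image) (auto simp: simple_path_def intro: inj_on_inverseI)
  moreover have "path_image (h \<circ> e) = frontier K"
    using hom pim unfolding path_image_compose by (simp add: homeomorphism_def)
  moreover have "e 0 = e 1" by (simp add: e_def complex_eq_iff)
  then have "pathfinish (h \<circ> e) = pathstart (h \<circ> e)"
    by (simp add: pathfinish_def pathstart_def)
  ultimately show ?thesis unfolding closed_curve_onto_def by blast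
qed

lemma perimeter_curve:
  assumes "convex_body K"
  obtains g where "closed_curve_onto g (frontier K)" "perimeter K = curve_length g"
  using someI_ex[OF closed_curve_onto_frontier_exists[OF assms]] that unfolding perimeter_def by blast

lemma curve_length_le:
  assumes "\<And>n t. \<forall>i\<le>n. t i \<in> {0..1} \<Longrightarrow> \<forall>i<n. t i \<le> t (Suc i) \<Longrightarrow>
             (\<Sum>i<n. dist (g (t i)) (g (t (Suc i)))) \<le> L"
  shows "curve_length g \<le> L"
  unfolding curve_length_def
proof (rule cSup_least)
  show "{(\<Sum>i<n. dist (g (t i)) (g (t (Suc i)))) | n t.
            (\<forall>i\<le>n. t i \<in> {0..1}) \<and> (\<forall>i<n. t i \<le> t (Suc i))} \<noteq> {}"
    by (auto intro!: exI[of _ 0] exI[of _ "\<lambda>_. 0"])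
qed (use assms in blast)

text \<open>Triangles with apex \<open>c\<close> over short chords of the boundary have height at least about \<open>r\<close>, and they do not
overlap.\<close>

lemma inradius_perimeter_le:
  assumes "convex_body K" "cball c r \<subseteq> K" "0 < r"
  shows "perimeter K \<le> 2 * area K / r"
proof -
  obtain g where g: "closed_curve_onto g (frontier K)" "perimeter K = curve_length g"
    using perimeter_curve[OF assms(1)] .
  show ?thesis unfolding g(2) by (rule curve_length_le) (rule inscribed_length_le[OF assms g(1)])
qed

text \<open>The chord from \<open>g t3\<close> to \<open>g t1\<close> is at most as long as the detour through the base point \<open>g 0 = g 1\<close>, which turns the
three chords into an inscribed polygonal line. The bound \<open>L\<close> makes the supremum in the definition of
length a genuine one.\<close>

lemma three_chords_le_curve_length:
  assumes bdd: "\<And>n t. \<forall>i\<le>n. t i \<in> {0..1} \<Longrightarrow> \<forall>i<n. t i \<le> t (Suc i) \<Longrightarrow>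
             (\<Sum>i<n. dist (g (t i)) (g (t (Suc i)))) \<le> L"
    and closed: "g 0 = g 1" and t: "0 \<le> t1" "t1 \<le> t2" "t2 \<le> t3" "t3 \<le> 1"
  shows "dist (g t1) (g t2) + dist (g t2) (g t3) + dist (g t3) (g t1) \<le> curve_length g"
proof -
  define S where "S = {(\<Sum>i<n. dist (g (t i)) (g (t (Suc i)))) | n t.
            (\<forall>i\<le>n. t i \<in> {0..1}) \<and> (\<forall>i<n. t i \<le> t (Suc i))}"
  \<comment> \<open>The polygonal line starts and ends at the base point.\<close>
  define w where "w = (!) [0, t1, t2, t3, 1]"
  have w: "w 0 = 0" "w 1 = t1" "w 2 = t2" "w 3 = t3" "w 4 = 1" by (simp_all add: w_def)
  have all4: "(\<forall>i\<le>4. P i) \<longleftrightarrow> P 0 \<and> P 1 \<and> P 2 \<and> P 3 \<and> P (4::nat)"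
    "(\<forall>i<4. P i) \<longleftrightarrow> P 0 \<and> P 1 \<and> P 2 \<and> P (3::nat)" for P
    by (auto simp: le_Suc_eq less_Suc_eq eval_nat_numeral)
  have sum4: "(\<Sum>i<4. f i) = f 0 + f 1 + f 2 + f (3::nat)" for f :: "nat \<Rightarrow> real"
    by (simp add: eval_nat_numeral)
  have suc: "Suc 0 = 1" "Suc 1 = 2" "Suc 2 = 3" "Suc 3 = 4" by auto
  have "(\<Sum>i<4. dist (g (w i)) (g (w (Suc i)))) \<in> S"
    unfolding S_def by (rule CollectI, rule exI[of _ 4], rule exI[of _ w])
      (use t in \<open>simp only: all4 suc w, simp\<close>)
  moreover have "bdd_above S" unfolding S_def using bdd by (intro bdd_aboveI[of _ L]) blast
  ultimately have "(\<Sum>i<4. dist (g (w i)) (g (w (Suc i)))) \<le> curve_length g"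
    unfolding curve_length_def S_def[symmetric] by (rule cSup_upper)
  then have "dist (g 0) (g t1) + dist (g t1) (g t2) + dist (g t2) (g t3) + dist (g t3) (g 1) \<le> curve_length g"
    by (simp only: sum4 suc w)
  moreover have "dist (g t3) (g t1) \<le> dist (g t3) (g 1) + dist (g 0) (g t1)"
    using dist_triangle[of "g t3" "g t1" "g 1"] closed by simp
  ultimately show ?thesis by linarith
qed

lemma perimeter_nonneg:
  assumes "convex_body K"
  shows "0 \<le> perimeter K"
proof -
  obtain z r where zr: "0 < r" "cball z r \<subseteq> K"
    using assms unfolding convex_body_def by (metis ex_in_conv mem_interior_cball)
  obtain g where g: "closed_curve_onto g (frontier K)" "perimeter K = curve_length g"
    using perimeter_curve[OF assms] .
  have "g 0 = g 1" using g(1) by (simp add: closed_curve_onto_def pathfinish_def pathstart_def)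
  from three_chords_le_curve_length[of g, OF inscribed_length_le[OF assms zr(2,1) g(1)] this, of 0 0 0]
  show ?thesis using g(2) by simp
qed

section \<open>The regular triangle\<close>

text \<open>The vertices are on the frontier, and a closed curve through them is at least as long as the three edges. An
equilateral triangle with edge \<open>l\<close> has area \<open>\<surd>3/4 l\<^sup>2\<close>.\<close>

lemma equilateral_isoperimetric_ratio:
  assumes "a \<noteq> b" "dist a b = dist b c" "dist b c = dist c a"
  shows "cross (b - a) (c - a) \<noteq> 0"
    and "12 * sqrt 3 \<le> (perimeter (convex hull {a, b, c}))\<^sup>2 / area (convex hull {a, b, c})"
proof -
  define T where "T = convex hull {a, b, c}"
  define l where "l = dist a b"
  have l: "0 < l" using assms(1) by (simp add: l_def)
  have sq: "(b $ 1 - a $ 1)\<^sup>2 + (b $ 2 - a $ 2)\<^sup>2 = l\<^sup>2" "(c $ 1 - a $ 1)\<^sup>2 + (c $ 2 - a $ 2)\<^sup>2 = l\<^sup>2"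
    "(c $ 1 - b $ 1)\<^sup>2 + (c $ 2 - b $ 2)\<^sup>2 = l\<^sup>2"
    using assms(2,3) unfolding l_def dist_norm
    by (simp_all add: norm_vec2_sq[symmetric, of "b - a", simplified] norm_vec2_sq[symmetric, of "c - a", simplified]
       norm_vec2_sq[symmetric, of "c - b", simplified] norm_minus_commute)
  have "4 * (cross (b - a) (c - a))\<^sup>2 = 3 * (l\<^sup>2)\<^sup>2"
    using sq unfolding cross_def vector_minus_component by algebra
  then have "(\<bar>cross (b - a) (c - a)\<bar>)\<^sup>2 = (sqrt 3 / 2 * l\<^sup>2)\<^sup>2"
    by (simp add: power_mult_distrib power_divide)
  then have cr: "\<bar>cross (b - a) (c - a)\<bar> = sqrt 3 / 2 * l\<^sup>2"
    using l by (subst (asm) power2_eq_iff_nonneg) auto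
  then show nz: "cross (b - a) (c - a) \<noteq> 0" using l by auto
  have aT: "area T = sqrt 3 / 4 * l\<^sup>2" unfolding T_def area_triangle cr by simp
  have cT: "compact T" "convex T" by (simp_all add: T_def finite_imp_compact_convex_hull)
  have body: "convex_body T" using cT area_pos_iff[OF cT] aT l by (auto simp: convex_body_def)
  then obtain z r where zr: "0 < r" "cball z r \<subseteq> T"
    unfolding convex_body_def by (metis ex_in_conv mem_interior_cball)
  obtain g where g: "closed_curve_onto g (frontier T)" "perimeter T = curve_length g"
    using perimeter_curve[OF body] .
  have gT: "path_image g = frontier T" "g 0 = g 1"
    using g(1) by (auto simp: closed_curve_onto_def pathfinish_def pathstart_def)
  have vertex: "x \<in> frontier (convex hull {x, y, z})" if "cross (y - x) (z - x) \<noteq> 0" for x y z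
  proof -
    have "x \<notin> convex hull {y, z}"
    proof
      assume "x \<in> convex hull {y, z}"
      then obtain u where "x = (1 - u) *\<^sub>R y + u *\<^sub>R z"
        by (auto simp: segment_convex_hull[symmetric] closed_segment_def)
      then have "y - x = (- u) *\<^sub>R (z - y)" "z - x = (1 - u) *\<^sub>R (z - y)" by (simp_all add: algebra_simps)
      then have "cross (y - x) (z - x) = 0" by (simp only: cross_def) simp
      then show False using that by simp
    qed
    then have "x extreme_point_of (convex hull {x, y, z})"
      by (intro extreme_point_of_convex_hull_insert) auto
    then have "x \<notin> interior (convex hull {x, y, z})" by (rule extreme_point_not_in_interior)
    moreover have "x \<in> closure (convex hull {x, y, z})"
      by (meson closure_subset hull_inc insertI1 subsetD)
    ultimately show ?thesis by (simp add: frontier_def)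
  qed
  have perm: "{b, c, a} = {a, b, c}" "{c, a, b} = {a, b, c}" by auto
  have nz2: "cross (c - b) (a - b) \<noteq> 0" "cross (a - c) (b - c) \<noteq> 0"
    using nz by (auto simp: cross_def algebra_simps)
  have "a \<in> frontier T" "b \<in> frontier T" "c \<in> frontier T"
    using vertex[OF nz] vertex[OF nz2(1)] vertex[OF nz2(2)] by (simp_all add: T_def perm)
  then obtain ta tb tc where tt: "ta \<in> {0..1}" "tb \<in> {0..1}" "tc \<in> {0..1}" "g ta = a" "g tb = b" "g tc = c"
    unfolding gT(1)[symmetric] path_image_def by blast
  note three = three_chords_le_curve_length[of g, OF inscribed_length_le[OF body zr(2,1) g(1)] gT(2)]
  have dd: "dist a b = l" "dist b c = l" "dist c a = l" "dist b a = l" "dist c b = l" "dist a c = l"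
    using assms(2,3) by (simp_all add: l_def dist_commute)
  consider "ta \<le> tb" "tb \<le> tc" | "ta \<le> tc" "tc \<le> tb" | "tb \<le> ta" "ta \<le> tc"
    | "tb \<le> tc" "tc \<le> ta" | "tc \<le> ta" "ta \<le> tb" | "tc \<le> tb" "tb \<le> ta" by linarith
  then have "3 * l \<le> perimeter T"
  proof cases
    case 1 then show ?thesis using three[of ta tb tc] tt dd g(2) by simp
  next
    case 2 then show ?thesis using three[of ta tc tb] tt dd g(2) by simp
  next
    case 3 then show ?thesis using three[of tb ta tc] tt dd g(2) by simp
  next
    case 4 then show ?thesis using three[of tb tc ta] tt dd g(2) by simp
  next
    case 5 then show ?thesis using three[of tc ta tb] tt dd g(2) by simp
  next
    case 6 then show ?thesis using three[of tc tb ta] tt dd g(2) by simp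
  qed
  then have "(3 * l)\<^sup>2 \<le> (perimeter T)\<^sup>2" using l by (intro power_mono) auto
  moreover have "12 * sqrt 3 * area T = (3 * l)\<^sup>2" unfolding aT by (simp add: power_mult_distrib)
  moreover have pos: "0 < area T" unfolding aT using l by simp
  ultimately show "12 * sqrt 3 \<le> (perimeter (convex hull {a, b, c}))\<^sup>2 / area (convex hull {a, b, c})"
    unfolding T_def[symmetric] pos_le_divide_eq[OF pos] by linarith
qed

section \<open>Volume distance to a triangle\<close>

text \<open>The linear map that takes \<open>u, w\<close> to \<open>u', w'\<close> has positive determinant \<open>cross u' w' / cross u w\<close>; the factor
\<open>l\<close> normalizes it to 1.\<close>

lemma unimodular_matching:
  fixes u w u' w' :: "real^2"
  assumes "0 < cross u w * cross u' w'"
  obtains \<Phi> :: "real^2^2" and l where "det \<Phi> = 1" "0 < l" "l\<^sup>2 = cross u w / cross u' w'"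
    "\<Phi> *v u = l *\<^sub>R u'" "\<Phi> *v w = l *\<^sub>R w'"
proof -
  define l where "l = sqrt (cross u w / cross u' w')"
  have pos: "0 < cross u w / cross u' w'" using assms by (simp add: zero_less_mult_iff zero_less_divide_iff)
  then have l: "0 < l" "l\<^sup>2 = cross u w / cross u' w'" by (simp_all add: l_def)
  define M :: "real^2^2" where "M = (\<chi> i j. if j = 1 then u $ i else w $ i)"
  define N :: "real^2^2" where "N = (\<chi> i j. if j = 1 then l * u' $ i else l * w' $ i)"
  have detM: "det M = cross u w" by (simp add: M_def det_2 cross_def)
  have detN: "det N = cross u w"
  proof -
    have "det N = l\<^sup>2 * cross u' w'" by (simp add: N_def det_2 cross_def power2_eq_square algebra_simps)
    then show ?thesis using l(2) assms by auto
  qed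
  have nz: "cross u w \<noteq> 0" using assms by auto
  then have "invertible M" by (simp add: invertible_det_nz detM)
  then obtain M' where inv: "M ** M' = mat 1" "M' ** M = mat 1" unfolding invertible_def by blast
  have "M *v axis 1 1 = u" "M *v axis 2 1 = w" "N *v axis 1 1 = l *\<^sub>R u'" "N *v axis 2 1 = l *\<^sub>R w'"
    by (simp_all add: M_def N_def vec2_eq_iff matrix_vector_mult_def sum_2 axis_def)
  moreover have "M' *v (M *v x) = x" for x
    using inv by (simp add: matrix_vector_mul_assoc)
  ultimately have "(N ** M') *v u = l *\<^sub>R u'" "(N ** M') *v w = l *\<^sub>R w'"
    by (metis matrix_vector_mul_assoc)+
  moreover have "det (N ** M') = 1"
  proof -
    have "det M * det (M') = 1"
      using inv by (metis det_I det_mul)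
    then show ?thesis by (simp add: det_mul detM detN)
  qed
  ultimately show ?thesis using l that by blast
qed

lemma in_triangle:
  fixes a b c :: "real^2"
  shows "x \<in> convex hull {a, b, c} \<longleftrightarrow>
    (\<exists>\<mu> \<nu>. 0 \<le> \<mu> \<and> 0 \<le> \<nu> \<and> \<mu> + \<nu> \<le> 1 \<and> x = a + \<mu> *\<^sub>R (b - a) + \<nu> *\<^sub>R (c - a))"
  unfolding convex_hull_3_alt by auto

text \<open>The unimodular part \<open>\<Phi>\<close> of the affine map between the triangles \<open>S\<close> and \<open>T\<close> takes the normalized \<open>K\<close> to a set
\<open>A\<close> of area 1 inside a triangle \<open>C\<close>, which is homothetic to \<open>T\<close> and has area \<open>V(S) / V(K) \<ge> 1\<close>. Hence \<open>C\<close> contains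
a translate \<open>B\<close> of the normalized \<open>T\<close> as well. The bound is the sum of the areas of \<open>C - A\<close> and \<open>C - B\<close>.\<close>

lemma delta_vol_le_triangle_oriented:
  assumes K: "convex_body K" "K \<subseteq> convex hull {p, q, r}"
    and orient: "0 < cross (q - p) (r - p) * cross (b - a) (c - a)"
  shows "delta_vol K (convex hull {a, b, c}) \<le> 2 * (area (convex hull {p, q, r}) / area K - 1)"
proof -
  define T where "T = convex hull {a, b, c}"
  define S where "S = convex hull {p, q, r}"
  define \<alpha> where "\<alpha> = area K powr (- 1 / 2)"
  define \<beta> where "\<beta> = area T powr (- 1 / 2)"
  obtain \<Phi> :: "real^2^2" and l where \<Phi>: "det \<Phi> = 1" "0 < l"
    "l\<^sup>2 = cross (q - p) (r - p) / cross (b - a) (c - a)"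
    "\<Phi> *v (q - p) = l *\<^sub>R (b - a)" "\<Phi> *v (r - p) = l *\<^sub>R (c - a)"
    using unimodular_matching[OF orient] by metis
  have cK: "compact K" "convex K" and vK: "0 < area K"
    using K(1) area_pos_iff[of K] by (auto simp: convex_body_def)
  have vT: "0 < area T" using orient by (auto simp: T_def area_triangle)
  have KS: "area K \<le> area S"
    using K(2) cK(1) unfolding S_def
    by (intro measure_mono_fmeasurable) (auto simp: lmeasurable_triangle lmeasurable_compact fmeasurableD)
  have l2: "l\<^sup>2 = area S / area T"
    using \<Phi>(3) orient unfolding S_def T_def area_triangle
    by (auto simp: zero_less_mult_iff)
  have \<alpha>: "0 < \<alpha>" "\<alpha>\<^sup>2 = 1 / area K" and \<beta>: "0 < \<beta>" "\<beta>\<^sup>2 = 1 / area T"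
    using vK vT by (simp_all add: \<alpha>_def \<beta>_def powr_minus powr_half_sqrt inverse_eq_divide power_divide)
  \<comment> \<open>This translation moves the vertex \<open>\<beta> a\<close> to the image of \<open>\<alpha> p\<close>, a common vertex of \<open>B\<close> and \<open>C\<close>.\<close>
  define x where "x = \<alpha> *\<^sub>R (\<Phi> *v p) - \<beta> *\<^sub>R a"
  define A where "A = (\<lambda>y. \<Phi> *v y) ` ((\<lambda>y. \<alpha> *\<^sub>R y) ` K)"
  define B where "B = (\<lambda>y. x + y) ` ((\<lambda>y. \<beta> *\<^sub>R y) ` T)"
  define C where "C = (\<lambda>y. \<Phi> *v y) ` ((\<lambda>y. \<alpha> *\<^sub>R y) ` S)"
  have cT: "compact T" "compact S" by (simp_all add: T_def S_def finite_imp_compact_convex_hull)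
  have cimg: "compact ((\<lambda>y. s *\<^sub>R y) ` X)" if "compact X" for s and X :: "(real^2) set"
    using that by (rule compact_scaling)
  have cphi: "compact ((\<lambda>y. \<Phi> *v y) ` X)" if "compact X" for X
    using that by (intro compact_continuous_image continuous_intros)
  have meas: "A \<in> lmeasurable" "B \<in> lmeasurable" "C \<in> lmeasurable"
    unfolding A_def B_def C_def using cK cT
    by (auto intro!: lmeasurable_compact cphi cimg compact_translation)
  have aA: "area A = 1" unfolding A_def using vK cK \<alpha> \<Phi>(1)
    by (subst area_matrix_image) (auto simp: area_scale_image lmeasurable_compact cimg)
  have aC: "area C = area S / area K" unfolding C_def using vK cT \<alpha> \<Phi>(1)
    by (subst area_matrix_image) (auto simp: area_scale_image lmeasurable_compact cimg)
  have aB: "area B = 1" unfolding B_def measure_translation area_scale_image using \<beta> vT by simp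
  have AC: "A \<subseteq> C" unfolding A_def C_def using K(2) by (auto simp: S_def)
  have bal: "\<beta> \<le> \<alpha> * l"
  proof (rule power2_le_imp_le)
    show "\<beta>\<^sup>2 \<le> (\<alpha> * l)\<^sup>2"
      using KS vK vT by (simp add: power_mult_distrib \<alpha>(2) \<beta>(2) l2 field_simps)
  qed (use \<alpha> \<Phi> in auto)
  have BC: "B \<subseteq> C"
  proof
    fix z assume "z \<in> B"
    then obtain \<mu> \<nu> where mn: "0 \<le> \<mu>" "0 \<le> \<nu>" "\<mu> + \<nu> \<le> 1"
      and z: "z = x + \<beta> *\<^sub>R (a + \<mu> *\<^sub>R (b - a) + \<nu> *\<^sub>R (c - a))"
      unfolding B_def T_def by (auto simp: in_triangle)
    define k where "k = \<beta> / (\<alpha> * l)"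
    have k: "0 \<le> k" "k \<le> 1" "\<alpha> * k * l = \<beta>" using \<alpha> \<beta> \<Phi>(2) bal by (auto simp: k_def)
    define y where "y = p + (k * \<mu>) *\<^sub>R (q - p) + (k * \<nu>) *\<^sub>R (r - p)"
    have "k * \<mu> + k * \<nu> = k * (\<mu> + \<nu>)" by (simp add: distrib_left)
    also have "\<dots> \<le> 1" using k mn by (intro mult_le_one) auto
    finally have "y \<in> S" unfolding S_def in_triangle y_def using k mn by (metis mult_nonneg_nonneg)
    moreover have "z = \<Phi> *v (\<alpha> *\<^sub>R y)"
    proof -
      have "\<Phi> *v (\<alpha> *\<^sub>R y) = \<alpha> *\<^sub>R (\<Phi> *v p + (k * \<mu>) *\<^sub>R (\<Phi> *v (q - p)) + (k * \<nu>) *\<^sub>R (\<Phi> *v (r - p)))"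
        unfolding y_def by (simp only: matrix_vector_right_distrib matrix_vector_mult_scaleR)
      also have "\<dots> = \<alpha> *\<^sub>R (\<Phi> *v p) + (\<alpha> * k * l) *\<^sub>R (\<mu> *\<^sub>R (b - a) + \<nu> *\<^sub>R (c - a))"
        unfolding \<Phi>(4,5) by (simp add: scaleR_add_right mult_ac)
      also have "\<dots> = z" unfolding k(3) z x_def by (simp add: algebra_simps)
      finally show ?thesis by simp
    qed
    ultimately show "z \<in> C" unfolding C_def by blast
  qed
  have "area (sym_diff A B) \<le> area (A - B) + area (B - A)"
    using meas by (intro measure_Un_le) (auto simp: fmeasurableD)
  also have "\<dots> \<le> area (C - B) + area (C - A)"
    using meas AC BC by (intro add_mono measure_mono_fmeasurable) (auto simp: fmeasurable.Diff)
  also have "\<dots> = 2 * (area S / area K - 1)"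
    using meas AC BC by (simp add: measurable_measure_Diff fmeasurableD aA aB aC)
  finally have fin: "area (sym_diff A B) \<le> 2 * (area S / area K - 1)" .
  have "delta_vol K T \<le> area (sym_diff A B)"
    unfolding delta_vol_def Let_def \<alpha>_def[symmetric] \<beta>_def[symmetric]
  proof (rule cInf_lower)
    show "area (sym_diff A B) \<in> {area (sym_diff ((\<lambda>y. \<Phi> *v y) ` ((\<lambda>y. \<alpha> *\<^sub>R y) ` K))
                          ((\<lambda>y. x + y) ` ((\<lambda>y. \<beta> *\<^sub>R y) ` T))) | (\<Phi> :: real^2^2) x. det \<Phi> = 1}"
      unfolding A_def B_def using \<Phi>(1) by blast
  qed (auto intro!: bdd_belowI[of _ 0])
  then show ?thesis using fin by (simp add: T_def S_def)
qed

text \<open>The hypothesis on the orientation is achieved by interchanging two vertices.\<close>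

lemma delta_vol_le_triangle:
  assumes K: "convex_body K" "K \<subseteq> convex hull {p, q, r}" and T: "cross (b - a) (c - a) \<noteq> 0"
  shows "delta_vol K (convex hull {a, b, c}) \<le> 2 * (area (convex hull {p, q, r}) / area K - 1)"
proof -
  have "0 < area K" using K(1) area_pos_iff[of K] by (auto simp: convex_body_def)
  also have "area K \<le> area (convex hull {p, q, r})"
    using K by (intro measure_mono_fmeasurable)
      (auto simp: convex_body_def lmeasurable_triangle lmeasurable_compact fmeasurableD)
  finally have nz: "cross (q - p) (r - p) \<noteq> 0" by (auto simp: area_triangle)
  have swap: "cross (r - p) (q - p) = - cross (q - p) (r - p)" by (simp add: cross_def)
  show ?thesis
  proof (cases "0 < cross (q - p) (r - p) * cross (b - a) (c - a)")
    case True then show ?thesis by (rule delta_vol_le_triangle_oriented[OF K])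
  next
    case False
    then have "0 < cross (r - p) (q - p) * cross (b - a) (c - a)"
      using nz T unfolding swap by (auto simp: mult_less_0_iff not_less less_le)
    moreover have "{p, r, q} = {p, q, r}" by auto
    ultimately show ?thesis using delta_vol_le_triangle_oriented[of K p r q b a c] K by simp
  qed
qed

section \<open>Polygons circumscribed about the unit disc\<close>

definition dir :: "real \<Rightarrow> real^2" where
  "dir \<theta> = (\<chi> i. if i = 1 then cos \<theta> else sin \<theta>)"

lemma dir_nth [simp]: "dir \<theta> $ 1 = cos \<theta>" "dir \<theta> $ 2 = sin \<theta>"
  by (simp_all add: dir_def)

lemma dir_periodic [simp]: "dir (\<theta> + 2 * pi) = dir \<theta>"
  by (simp add: vec2_eq_iff)

lemma norm_dir [simp]: "norm (dir \<theta>) = 1"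
  by (rule power2_eq_imp_eq) (simp_all add: norm_vec2_sq)

lemma inner_dir: "dir \<theta> \<bullet> dir \<phi> = cos (\<theta> - \<phi>)"
  by (simp add: inner_vec2 cos_diff)

lemma cross_dir: "cross (dir \<theta>) (dir \<phi>) = sin (\<phi> - \<theta>)"
  by (simp add: cross_def sin_diff)

lemma continuous_dir: "continuous_on A dir"
  unfolding dir_def
proof (rule continuous_on_vec_lambda)
  show "continuous_on A (\<lambda>\<theta>. if i = 1 then cos \<theta> else sin \<theta>)" for i :: 2
    by (cases "i = 1") (auto intro: continuous_intros)
qed

text \<open>The vector \<open>dir \<theta>\<close> turned by a right angle; the direction of the tangent of the unit circle at \<open>dir \<theta>\<close>.\<close>

definition codir :: "real \<Rightarrow> real^2" where
  "codir \<theta> = (\<chi> i. if i = 1 then - sin \<theta> else cos \<theta>)"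

lemma codir_nth [simp]: "codir \<theta> $ 1 = - sin \<theta>" "codir \<theta> $ 2 = cos \<theta>"
  by (simp_all add: codir_def)

lemma norm_codir [simp]: "norm (codir \<theta>) = 1"
  by (rule power2_eq_imp_eq) (simp_all add: norm_vec2_sq)

lemma dir_add: "dir (\<theta> + t) = cos t *\<^sub>R dir \<theta> + sin t *\<^sub>R codir \<theta>"
  by (simp add: vec2_eq_iff cos_add sin_add)

lemma polar_from:
  obtains \<rho> t where "0 \<le> \<rho>" "0 \<le> t" "t \<le> 2 * pi" "(x::real^2) = \<rho> *\<^sub>R dir (\<theta> + t)"
proof (cases "x = 0")
  case True then show ?thesis using that[of 0 0] by simp
next
  case False
  define y1 y2 where "y1 = (x \<bullet> dir \<theta>) / norm x" and "y2 = (x \<bullet> codir \<theta>) / norm x"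
  have n: "norm x \<noteq> 0" using False by simp
  have cs: "(cos \<theta>)\<^sup>2 + (sin \<theta>)\<^sup>2 = 1" by simp
  have "(x \<bullet> dir \<theta>)\<^sup>2 + (x \<bullet> codir \<theta>)\<^sup>2 = (norm x)\<^sup>2"
    unfolding inner_vec2 norm_vec2_sq dir_nth codir_nth using cs by algebra
  then have "y1\<^sup>2 + y2\<^sup>2 = 1" using n by (simp add: y1_def y2_def power_divide add_divide_distrib[symmetric])
  then obtain t where t: "0 \<le> t" "t < 2 * pi" "y1 = cos t" "y2 = sin t"
    using sincos_total_2pi by metis
  have e: "x \<bullet> dir \<theta> = norm x * cos t" "x \<bullet> codir \<theta> = norm x * sin t"
    using t(3,4) n by (simp_all add: y1_def y2_def field_simps)
  have "x = (x \<bullet> dir \<theta>) *\<^sub>R dir \<theta> + (x \<bullet> codir \<theta>) *\<^sub>R codir \<theta>"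
    unfolding vec2_eq_iff inner_vec2 using cs 
    by (simp only: vector_add_component vector_scaleR_component dir_nth codir_nth real_scaleR_def) algebra
  then have "x = norm x *\<^sub>R dir (\<theta> + t)" by (simp add: e dir_add scaleR_add_right)
  then show ?thesis using that[of "norm x" t] t by auto
qed

text \<open>The point where the tangents of the unit circle at \<open>dir \<theta>\<close> and \<open>dir (\<theta> + 2 h)\<close> meet; negative \<open>h\<close> are
allowed.\<close>

definition tangent_vertex :: "real \<Rightarrow> real \<Rightarrow> real^2" where
  "tangent_vertex \<theta> h = (1 / cos h) *\<^sub>R dir (\<theta> + h)"

lemma tangent_vertex_eq:
  assumes "cos h \<noteq> 0"
  shows "tangent_vertex \<theta> h = dir \<theta> + tan h *\<^sub>R codir \<theta>"
  using assms by (simp add: tangent_vertex_def dir_add scaleR_add_right tan_def)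

lemma area_wedge: "area (convex hull {0, dir \<theta>, tangent_vertex \<theta> h}) = \<bar>tan h\<bar> / 2"
proof -
  have "cross (dir \<theta>) (tangent_vertex \<theta> h) = (1 / cos h) * cross (dir \<theta>) (dir (\<theta> + h))"
    by (simp add: tangent_vertex_def cross_def diff_divide_distrib)
  then show ?thesis by (simp add: area_triangle cross_dir tan_def)
qed

text \<open>The triangle is right-angled at \<open>dir \<theta>\<close>, and it is the part of the sector between the angles \<open>\<theta>\<close> and
\<open>\<theta> + h\<close> that lies on the inner side of the tangent at \<open>dir \<theta>\<close>. The coefficients \<open>\<mu>\<close> and \<open>\<nu>\<close> come from the sine rule.\<close>

lemma wedge_covers:
  assumes h: "\<bar>h\<bar> < pi / 2" and s: "0 \<le> s" "s \<le> 1" and \<rho>: "0 \<le> \<rho>"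
    and x: "x = \<rho> *\<^sub>R dir (\<theta> + s * h)" and le: "x \<bullet> dir \<theta> \<le> 1"
  shows "x \<in> convex hull {0, dir \<theta>, tangent_vertex \<theta> h}"
proof (cases "h = 0")
  case True
  have "\<rho> \<le> 1" using le by (simp add: x True inner_dir)
  then show ?thesis using in_hull_zero2[of \<rho> 0 "dir \<theta>" "tangent_vertex \<theta> h"] \<rho> by (simp add: x True)
next
  case False
  have ch: "0 < cos h" using h by (intro cos_gt_zero_pi) auto
  have quot: "0 \<le> sin (k * h) / sin h" if "0 \<le> k" "k \<le> 1" for k
  proof (cases "0 < h")
    case True
    have "k * h \<le> h" using that True by (simp add: mult_le_cancel_right1)
    then have "k * h \<le> pi" using h pi_gt_zero by linarith
    then have "0 \<le> sin (k * h)" using that True by (intro sin_ge_zero) auto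
    moreover have "0 < sin h" using True h by (intro sin_gt_zero) auto
    ultimately show ?thesis by simp
  next
    case neg: False
    have "k * - h \<le> 1 * - h" using that neg by (intro mult_right_mono) auto
    then have "k * - h \<le> pi" using h pi_gt_zero by linarith
    then have "0 \<le> sin (k * - h)" using that neg by (intro sin_ge_zero mult_nonneg_nonneg) auto
    moreover have "0 < sin (- h)" using neg False h by (intro sin_gt_zero) auto
    ultimately show ?thesis by (simp add: divide_nonpos_neg)
  qed
  have sh: "sin h \<noteq> 0" using False h sin_eq_0_pi by auto
  define \<mu> where "\<mu> = \<rho> * (sin ((1 - s) * h) / sin h)"
  define \<nu> where "\<nu> = \<rho> * (sin (s * h) / sin h) * cos h"
  have "0 \<le> \<mu>" "0 \<le> \<nu>" unfolding \<mu>_def \<nu>_def using quot[of s] quot[of "1 - s"] s \<rho> ch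
    by (intro mult_nonneg_nonneg; simp)+
  moreover have sum: "\<mu> + \<nu> = \<rho> * cos (s * h)"
  proof -
    have "sin ((1 - s) * h) = sin h * cos (s * h) - cos h * sin (s * h)"
      by (simp add: left_diff_distrib sin_diff)
    then show ?thesis using sh unfolding \<mu>_def \<nu>_def by (simp only:) (simp add: field_simps)
  qed
  moreover have "\<rho> * cos (s * h) \<le> 1" using le by (simp add: x inner_dir)
  moreover have "x = \<mu> *\<^sub>R dir \<theta> + \<nu> *\<^sub>R tangent_vertex \<theta> h"
  proof -
    have "\<nu> * tan h = \<rho> * sin (s * h)" using ch sh by (simp add: \<nu>_def tan_def field_simps)
    then have "\<mu> *\<^sub>R dir \<theta> + \<nu> *\<^sub>R tangent_vertex \<theta> h
      = (\<mu> + \<nu>) *\<^sub>R dir \<theta> + (\<rho> * sin (s * h)) *\<^sub>R codir \<theta>"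
      using ch by (simp add: tangent_vertex_eq scaleR_add_right scaleR_add_left)
    also have "\<dots> = x" unfolding sum x by (simp add: dir_add scaleR_add_right)
    finally show ?thesis by simp
  qed
  ultimately show ?thesis using in_hull_zero2 by metis
qed

lemma monotone_partition_cover:
  fixes \<psi> :: "nat \<Rightarrow> real"
  assumes "\<psi> 0 \<le> x" "x \<le> \<psi> n" "0 < n"
  obtains i where "i < n" "\<psi> i \<le> x" "x \<le> \<psi> (Suc i)"
proof -
  have "\<exists>i<n. \<psi> i \<le> x \<and> x \<le> \<psi> (Suc i)" using assms
  proof (induction n)
    case (Suc n)
    show ?case
    proof (cases "0 < n \<and> x \<le> \<psi> n")
      case True then show ?thesis using Suc by (meson less_SucI)
    next
      case False then show ?thesis using Suc by (intro exI[of _ n]) auto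
    qed
  qed simp
  then show ?thesis using that by blast
qed

text \<open>Consecutive tangents meet at the bisector of the angle between them. Each half of that angle contributes one right triangle.\<close>

lemma tangent_wedges_cover:
  fixes \<psi> :: "nat \<Rightarrow> real"
  assumes tang: "\<And>i. i \<le> n \<Longrightarrow> x \<bullet> dir (\<psi> i) \<le> 1"
    and gap: "\<And>i. i < n \<Longrightarrow> 0 \<le> h i \<and> h i < pi / 2 \<and> \<psi> (Suc i) = \<psi> i + 2 * h i"
    and turn: "\<psi> n = \<psi> 0 + 2 * pi"
  obtains i where "i < n" "x \<in> convex hull {0, dir (\<psi> i), tangent_vertex (\<psi> i) (h i)} \<union>
                       convex hull {0, dir (\<psi> (Suc i)), tangent_vertex (\<psi> (Suc i)) (- h i)}"
proof -
  obtain \<rho> t where p: "0 \<le> \<rho>" "0 \<le> t" "t \<le> 2 * pi" "x = \<rho> *\<^sub>R dir (\<psi> 0 + t)" using polar_from by blast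
  have n: "0 < n" using turn by (cases n) auto
  obtain i where i: "i < n" "\<psi> i \<le> \<psi> 0 + t" "\<psi> 0 + t \<le> \<psi> (Suc i)"
    using monotone_partition_cover[of \<psi> "\<psi> 0 + t" n] p turn n by auto
  note g = gap[OF i(1)]
  define d where "d = \<psi> 0 + t - \<psi> i"
  have d: "0 \<le> d" "d \<le> 2 * h i" "\<psi> 0 + t = \<psi> i + d" using i g by (auto simp: d_def)
  show ?thesis
  proof (cases "h i = 0")
    case True
    then have "d = 0" using d by simp
    then have "x \<in> convex hull {0, dir (\<psi> i), tangent_vertex (\<psi> i) (h i)}"
      using g p d tang[of i] i True by (intro wedge_covers[of _ 0 \<rho>]) auto
    then show ?thesis using that i(1) by blast
  next
    case False
    then have hpos: "0 < h i" using g by simp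
    show ?thesis
    proof (cases "d \<le> h i")
      case True
      have "x \<in> convex hull {0, dir (\<psi> i), tangent_vertex (\<psi> i) (h i)}"
        using g p d tang[of i] i True hpos by (intro wedge_covers[of _ "d / h i" \<rho>]) auto
      then show ?thesis using that i(1) by blast
    next
      case False
      have "x \<in> convex hull {0, dir (\<psi> (Suc i)), tangent_vertex (\<psi> (Suc i)) (- h i)}"
        using g p d tang[of "Suc i"] i False hpos
        by (intro wedge_covers[of _ "(2 * h i - d) / h i" \<rho>]) auto
      then show ?thesis using that i(1) by blast
    qed
  qed
qed

text \<open>Right triangles with a leg of length 1 and angle \<open>h i\<close> have area \<open>tan (h i) / 2\<close>, and there are two of
them for each \<open>i\<close>.\<close>

lemma area_le_sum_tan:
  fixes \<psi> :: "nat \<Rightarrow> real"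
  assumes S: "compact S" and tang: "\<And>i x. i \<le> n \<Longrightarrow> x \<in> S \<Longrightarrow> x \<bullet> dir (\<psi> i) \<le> 1"
    and gap: "\<And>i. i < n \<Longrightarrow> 0 \<le> h i \<and> h i < pi / 2 \<and> \<psi> (Suc i) = \<psi> i + 2 * h i"
    and turn: "\<psi> n = \<psi> 0 + 2 * pi"
  shows "area S \<le> (\<Sum>i<n. tan (h i))"
proof -
  define W where "W i = convex hull {0, dir (\<psi> i), tangent_vertex (\<psi> i) (h i)} \<union>
                       convex hull {0, dir (\<psi> (Suc i)), tangent_vertex (\<psi> (Suc i)) (- h i)}" for i
  have W: "W i \<in> lmeasurable" for i unfolding W_def by (intro fmeasurable.Un lmeasurable_triangle)
  have "S \<subseteq> (\<Union>i<n. W i)"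
  proof
    fix x assume "x \<in> S"
    then obtain i where "i < n" "x \<in> W i"
      using tangent_wedges_cover[of n x \<psi> h, OF _ gap turn] tang unfolding W_def by metis
    then show "x \<in> (\<Union>i<n. W i)" by auto
  qed
  then have "area S \<le> area (\<Union>i<n. W i)"
    using S W by (intro measure_mono_fmeasurable) (auto simp: lmeasurable_compact fmeasurableD)
  also have "\<dots> \<le> (\<Sum>i<n. area (W i))"
    using W by (intro measure_UNION_le) (auto simp: fmeasurableD)
  also have "\<dots> \<le> (\<Sum>i<n. tan (h i))"
  proof (rule sum_mono)
    fix i assume "i \<in> {..<n}"
    then have h: "0 \<le> h i" "h i < pi / 2" using gap[of i] by auto
    then have t: "0 \<le> tan (h i)" using tan_pos_pi2_le by auto
    have "area (W i) \<le> area (convex hull {0, dir (\<psi> i), tangent_vertex (\<psi> i) (h i)}) + 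
      area (convex hull {0, dir (\<psi> (Suc i)), tangent_vertex (\<psi> (Suc i)) (- h i)})"
      unfolding W_def by (intro measure_Un_le fmeasurableD lmeasurable_triangle)
    also have "\<dots> = tan (h i)" unfolding area_wedge using t by simp
    finally show "area (W i) \<le> tan (h i)" .
  qed
  finally show ?thesis .
qed

lemma cos_le_between:
  assumes "0 \<le> h" "h \<le> pi" "h \<le> x" "x \<le> 2 * pi - h"
  shows "cos x \<le> cos h"
proof (cases "x \<le> pi")
  case True then show ?thesis using assms by (intro cos_monotone_0_pi_le) auto
next
  case False
  then have "cos (2 * pi - x) \<le> cos h" using assms by (intro cos_monotone_0_pi_le) auto
  then show ?thesis by (simp add: cos_diff)
qed

text \<open>The vertex has distance \<open>1 / cos h\<close> from 0, and the angle between it and \<open>dir \<phi>\<close> is at least \<open>h\<close>.\<close>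

lemma tangent_vertex_inner_le:
  assumes "0 \<le> h" "h < pi / 2" "\<theta> + 2 * h \<le> \<phi>" "\<phi> \<le> \<theta> + 2 * pi"
  shows "tangent_vertex \<theta> h \<bullet> dir \<phi> \<le> 1"
proof -
  have "cos (\<theta> + h - \<phi>) = cos (\<phi> - (\<theta> + h))" by (metis cos_minus minus_diff_eq)
  also have "\<dots> \<le> cos h" using assms by (intro cos_le_between) auto
  finally have "cos (\<theta> + h - \<phi>) \<le> cos h" .
  moreover have "0 < cos h" using assms by (intro cos_gt_zero_pi) auto
  ultimately show ?thesis by (simp add: tangent_vertex_def inner_dir divide_le_eq)
qed

lemma dir_in_edge:
  assumes "0 < h" "h < pi / 2" "0 < k" "k < pi / 2"
  shows "dir \<theta> \<in> convex hull {tangent_vertex \<theta> (- h), tangent_vertex \<theta> k}"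
proof -
  have c: "cos h \<noteq> 0" "cos k \<noteq> 0" using cos_gt_zero_pi[of h] cos_gt_zero_pi[of k] assms by auto
  have t: "0 < tan h" "0 < tan k" using assms by (auto intro: tan_gt_zero)
  define u where "u = tan h / (tan h + tan k)"
  have u: "0 \<le> u" "u \<le> 1" "u * (tan h + tan k) = tan h" using t by (auto simp: u_def)
  have "(1 - u) *\<^sub>R tangent_vertex \<theta> (- h) + u *\<^sub>R tangent_vertex \<theta> k
      = dir \<theta> + (u * (tan h + tan k) - tan h) *\<^sub>R codir \<theta>"
    using c by (simp add: tangent_vertex_eq algebra_simps)
  then have "dir \<theta> = (1 - u) *\<^sub>R tangent_vertex \<theta> (- h) + u *\<^sub>R tangent_vertex \<theta> k" using u by simp
  then show ?thesis using u by (auto simp: segment_convex_hull[symmetric] closed_segment_def)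
qed

text \<open>The weights \<open>sin (c - b)\<close>, \<open>sin (a - c)\<close>, \<open>sin (b - a)\<close> are the areas of the three triangles that 0 spans with two of the
points, up to the factor 2.\<close>

lemma zero_in_three_dirs:
  assumes "0 < sin (b - a)" "0 < sin (c - b)" "0 < sin (a - c)"
  shows "0 \<in> convex hull {dir a, dir b, dir c}"
proof -
  define s where "s = sin (b - a) + sin (c - b) + sin (a - c)"
  have s: "0 < s" using assms by (simp add: s_def)
  have "sin (c - b) *\<^sub>R dir a + sin (a - c) *\<^sub>R dir b + sin (b - a) *\<^sub>R dir c = 0"
    by (simp add: vec2_eq_iff sin_diff algebra_simps)
  then have "(1 / s) *\<^sub>R (sin (c - b) *\<^sub>R dir a + sin (a - c) *\<^sub>R dir b + sin (b - a) *\<^sub>R dir c) = 0" by simp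
  then have "(sin (c - b) / s) *\<^sub>R dir a + (sin (a - c) / s) *\<^sub>R dir b + (sin (b - a) / s) *\<^sub>R dir c = 0"
    by (simp add: scaleR_add_right)
  moreover have "sin (c - b) / s + sin (a - c) / s + sin (b - a) / s = 1"
    using s by (simp add: s_def add_divide_distrib[symmetric])
  moreover have "0 \<le> sin (c - b) / s" "0 \<le> sin (a - c) / s" "0 \<le> sin (b - a) / s" using assms s by auto
  ultimately show ?thesis unfolding convex_hull_3
    by (intro CollectI exI[of _ "sin (c - b) / s"] exI[of _ "sin (a - c) / s"] exI[of _ "sin (b - a) / s"]) auto
qed

text \<open>The convex hull of the vertices and the intersection of the three half-planes are the same set. The area bound
comes from the half-planes, which contain the hull. Conversely, a point of the
half-planes is in one of the right triangles, whose corners 0, \<open>dir \<theta>\<close> and \<open>tangent_vertex \<theta> h\<close> belong to the hull.\<close>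

lemma tangent_triangle:
  assumes h: "0 < h1" "h1 < pi / 2" "0 < h2" "h2 < pi / 2" "0 < h3" "h3 < pi / 2" "h1 + h2 + h3 = pi"
    and b: "b = a + 2 * h1" and c: "c = b + 2 * h2"
  defines "T \<equiv> convex hull {tangent_vertex a h1, tangent_vertex b h2, tangent_vertex c h3}"
  shows "area T \<le> tan h1 + tan h2 + tan h3"
    and "\<And>x. x \<bullet> dir a \<le> 1 \<Longrightarrow> x \<bullet> dir b \<le> 1 \<Longrightarrow> x \<bullet> dir c \<le> 1 \<Longrightarrow> x \<in> T"
proof -
  define \<psi> where "\<psi> = (!) [a, b, c, a + 2 * pi]"
  define k where "k = (!) [h1, h2, h3]"
  have v: "\<psi> 0 = a" "\<psi> 1 = b" "\<psi> 2 = c" "\<psi> 3 = a + 2 * pi" "k 0 = h1" "k 1 = h2" "k 2 = h3"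
    by (simp_all add: \<psi>_def k_def)
  have suc: "Suc 0 = 1" "Suc 1 = 2" "Suc 2 = 3" by auto
  have lt3: "i < 3 \<longleftrightarrow> i = 0 \<or> i = 1 \<or> i = 2" "i \<le> 3 \<longleftrightarrow> i = 0 \<or> i = 1 \<or> i = 2 \<or> i = 3" for i :: nat by auto
  have gap: "0 \<le> k i \<and> k i < pi / 2 \<and> \<psi> (Suc i) = \<psi> i + 2 * k i" if "i < 3" for i
    using that h b c unfolding lt3 by (elim disjE) (simp_all only: v suc, auto)
  have turn: "\<psi> 3 = \<psi> 0 + 2 * pi" by (simp add: v)
  have rv: "tangent_vertex b (- h1) = tangent_vertex a h1" "tangent_vertex c (- h2) = tangent_vertex b h2"
    by (simp_all add: tangent_vertex_def b c add.commute)
  have ca: "c + h3 = (a - h3) + 2 * pi" using h(7) by (simp add: b c)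
  have ca': "(a + 2 * pi) + - h3 = (a - h3) + 2 * pi" by simp
  have rv3: "tangent_vertex (a + 2 * pi) (- h3) = tangent_vertex c h3" 
    unfolding tangent_vertex_def ca ca' by simp
  have rv4: "tangent_vertex a (- h3) = tangent_vertex c h3" 
    unfolding tangent_vertex_def ca dir_periodic by simp
  have Tin: "x \<bullet> dir a \<le> 1 \<and> x \<bullet> dir b \<le> 1 \<and> x \<bullet> dir c \<le> 1" if "x \<in> T" for x
  proof -
    have conv: "convex {x. x \<bullet> dir \<theta> \<le> 1}" for \<theta>
      using convex_halfspace_le[of "dir \<theta>" 1] by (simp add: inner_commute)
    have per: "x \<bullet> dir \<theta> = x \<bullet> dir (\<theta> + 2 * pi)" for \<theta> x by simp
    have "tangent_vertex a h1 \<bullet> dir \<theta> \<le> 1 \<and> tangent_vertex b h2 \<bullet> dir \<theta> \<le> 1 \<and> tangent_vertex c h3 \<bullet> dir \<theta> \<le> 1"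
      if "\<theta> \<in> {a, b, c}" for \<theta>
    proof -
      have "tangent_vertex a h1 \<bullet> dir a \<le> 1" unfolding per[of _ a]
        by (intro tangent_vertex_inner_le; use h b c in linarith)
      moreover have "tangent_vertex a h1 \<bullet> dir b \<le> 1" "tangent_vertex a h1 \<bullet> dir c \<le> 1"
        "tangent_vertex b h2 \<bullet> dir c \<le> 1" by (intro tangent_vertex_inner_le; use h b c in linarith)+
      moreover have "tangent_vertex b h2 \<bullet> dir a \<le> 1" "tangent_vertex c h3 \<bullet> dir a \<le> 1" unfolding per[of _ a]
        by (intro tangent_vertex_inner_le; use h b c in linarith)+
      moreover have "tangent_vertex b h2 \<bullet> dir b \<le> 1" "tangent_vertex c h3 \<bullet> dir b \<le> 1" unfolding per[of _ b]
        by (intro tangent_vertex_inner_le; use h b c in linarith)+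
      moreover have "tangent_vertex c h3 \<bullet> dir c \<le> 1" unfolding per[of _ c]
        by (intro tangent_vertex_inner_le; use h b c in linarith)+
      ultimately show ?thesis using that by auto
    qed
    then have "T \<subseteq> {x. x \<bullet> dir \<theta> \<le> 1}" if "\<theta> \<in> {a, b, c}" for \<theta>
      unfolding T_def using that by (intro hull_minimal conv) auto
    then show ?thesis using \<open>x \<in> T\<close> by blast
  qed
  have tang: "x \<bullet> dir (\<psi> i) \<le> 1" if "i \<le> 3" "x \<bullet> dir a \<le> 1" "x \<bullet> dir b \<le> 1" "x \<bullet> dir c \<le> 1" for i x
    using that unfolding lt3 by (elim disjE) (simp_all only: v dir_periodic)
  have "compact T" by (simp add: T_def finite_imp_compact_convex_hull)
  then have "area T \<le> (\<Sum>i<3. tan (k i))"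
    using area_le_sum_tan[of T 3 \<psi> k, OF _ _ gap turn] tang Tin by blast
  also have "(\<Sum>i<3. tan (k i)) = tan h1 + tan h2 + tan h3"
    by (simp add: eval_nat_numeral k_def)
  finally show "area T \<le> tan h1 + tan h2 + tan h3" .
  have vT: "tangent_vertex a h1 \<in> T" "tangent_vertex b h2 \<in> T" "tangent_vertex c h3 \<in> T"
    unfolding T_def by (auto intro: hull_inc)
  have hullT: "convex hull X \<subseteq> T" if "X \<subseteq> T" for X
    using that unfolding T_def by (metis convex_convex_hull hull_minimal)
  have "dir a \<in> T" using dir_in_edge[of h3 h1 a] hullT[of "{tangent_vertex c h3, tangent_vertex a h1}"] h vT
    by (auto simp: rv4)
  moreover have "dir b \<in> T" using dir_in_edge[of h1 h2 b] hullT[of "{tangent_vertex a h1, tangent_vertex b h2}"] h vT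
    by (auto simp: rv)
  moreover have "dir c \<in> T" using dir_in_edge[of h2 h3 c] hullT[of "{tangent_vertex b h2, tangent_vertex c h3}"] h vT
    by (auto simp: rv)
  ultimately have dT: "dir a \<in> T" "dir b \<in> T" "dir c \<in> T" .
  have "0 \<in> convex hull {dir a, dir b, dir c}"
  proof (rule zero_in_three_dirs)
    show "0 < sin (b - a)" "0 < sin (c - b)" using h b c by (auto intro!: sin_gt_zero)
    have "sin (a - c) = sin (2 * h3)"
    proof -
      have "a - c = 2 * h3 - 2 * pi" using h(7) b c by auto
      then show ?thesis by (simp add: sin_diff)
    qed
    then show "0 < sin (a - c)" using h by (auto intro!: sin_gt_zero)
  qed
  then have zT: "0 \<in> T" using hullT[of "{dir a, dir b, dir c}"] dT by blast
  show "x \<in> T" if le: "x \<bullet> dir a \<le> 1" "x \<bullet> dir b \<le> 1" "x \<bullet> dir c \<le> 1" for x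
  proof -
    have tx: "x \<bullet> dir (\<psi> i) \<le> 1" if "i \<le> 3" for i using tang[OF that le] .
    obtain i where i: "i < 3" and x: "x \<in> convex hull {0, dir (\<psi> i), tangent_vertex (\<psi> i) (k i)} \<union>
                       convex hull {0, dir (\<psi> (Suc i)), tangent_vertex (\<psi> (Suc i)) (- k i)}"
      using tangent_wedges_cover[of 3 x \<psi> k thesis, OF tx gap turn] by blast
    have "{0, dir (\<psi> i), tangent_vertex (\<psi> i) (k i)} \<subseteq> T \<and>
          {0, dir (\<psi> (Suc i)), tangent_vertex (\<psi> (Suc i)) (- k i)} \<subseteq> T"
      using i zT dT vT unfolding lt3
      by (elim disjE) (simp_all only: v suc rv rv3 dir_periodic, simp_all)
    then show ?thesis using x hullT by blast
  qed
qed

section \<open>Contact points of a disc of maximal area\<close>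

text \<open>If \<open>K\<close> had a point \<open>x\<close> beyond the tangent, then \<open>dir z\<close> would lie between \<open>x\<close> and a point \<open>y\<close> of the
open unit disc, and it would be interior to \<open>K\<close>.\<close>

lemma contact_tangent:
  assumes K: "convex K" "cball 0 1 \<subseteq> K" and z: "dir z \<in> frontier K" and x: "x \<in> K"
  shows "x \<bullet> dir z \<le> 1"
proof (rule ccontr)
  assume "\<not> ?thesis"
  then have pos: "0 < (x - dir z) \<bullet> dir z" by (simp add: inner_diff_left inner_dir)
  define v where "v = x - dir z"
  have v: "0 < v \<bullet> dir z" "v \<noteq> 0" using pos by (auto simp: v_def)
  \<comment> \<open>This \<open>s\<close> minimizes the norm of \<open>dir z - s v\<close>.\<close>
  define s where "s = (v \<bullet> dir z) / (norm v)\<^sup>2"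
  have s: "0 < s" using v by (simp add: s_def)
  define y where "y = dir z - s *\<^sub>R v"
  have "(norm y)\<^sup>2 = 1 - 2 * s * (v \<bullet> dir z) + s * (s * (norm v)\<^sup>2)"
    unfolding y_def power2_norm_eq_inner
    by (simp add: inner_diff_left inner_diff_right inner_commute inner_dir algebra_simps)
  also have "s * (norm v)\<^sup>2 = v \<bullet> dir z" using v by (simp add: s_def)
  finally have "(norm y)\<^sup>2 = 1 - s * (v \<bullet> dir z)" by (simp add: algebra_simps)
  also have "\<dots> < 1\<^sup>2" using s v by simp
  finally have "norm y < 1" by (rule power_less_imp_less_base) simp
  then have "y \<in> interior K" using K(2) interior_mono[of "cball 0 1" K] by (auto simp: interior_cball)
  then have "x - (1 / (1 + s)) *\<^sub>R (x - y) \<in> interior K"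
    using x K(1) s by (intro mem_interior_convex_shrink) auto
  moreover have "x - y = (1 + s) *\<^sub>R v" by (simp add: y_def v_def algebra_simps)
  ultimately have "dir z \<in> interior K" using s by (simp add: v_def)
  then show False using z by (simp add: frontier_def)
qed

text \<open>The derivative of the right side at \<open>c = 0\<close> is \<open>3 - m\<close>; the bound on \<open>c\<close> keeps the term of second order
below the linear one.\<close>

lemma stretched_ellipse_area:
  fixes c m :: real
  assumes "0 < c" "0 < m" "m < 3" "c < (3 - m) / (3 * m)"
  shows "1 < (1 + c) ^ 3 * (1 - m * c)"
proof -
  have c1: "c * (3 * m) < 3 - m" using assms by (simp add: pos_less_divide_eq)
  have mc: "m * c < 1"
  proof -
    have "c * (3 * m) < 3" using c1 assms by linarith
    then show ?thesis by (simp add: mult.commute)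
  qed
  have "c * (c * (3 * m)) < c * (3 - m)" using c1 assms(1) by simp
  then have "1 < (1 + 3 * c) * (1 - m * c)" by (simp add: algebra_simps)
  also have "\<dots> \<le> (1 + c) ^ 3 * (1 - m * c)"
    using mc assms(1) by (intro mult_right_mono) (simp_all add: power3_eq_cube algebra_simps)
  finally show ?thesis .
qed

text \<open>The unit disc is a John ellipsoid. The determinant is the ratio of the area of the ellipse to that of the disc.\<close>

definition maximal_unit_disc :: "(real^2) set \<Rightarrow> bool" where
  "maximal_unit_disc K \<longleftrightarrow> cball 0 1 \<subseteq> K \<and>
     (\<forall>(M::real^2^2) d. det M \<noteq> 0 \<longrightarrow> (\<lambda>x. d + M *v x) ` cball 0 1 \<subseteq> K \<longrightarrow> \<bar>det M\<bar> \<le> 1)"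

text \<open>Suppose that the closed arc of half-length \<open>\<pi>/3\<close> around \<open>\<phi>\<close> is in the interior of \<open>K\<close>. By compactness, so is
a neighbourhood of a slightly longer arc, of half-length \<open>\<pi>/3 + \<eta>\<close>. In coordinates with first axis \<open>dir \<phi>\<close>, consider the
ellipse with centre \<open>(c, 0)\<close>, first semi-axis \<open>1 + c\<close> and second semi-axis \<open>b\<close>. Here \<open>b\<close> is chosen such
that the squared norm of the boundary point with parameter \<open>s\<close> is
\<open>1 + (1 + c) c (m + 1) (cos s + 1) (cos s - \<kappa>)\<close>, where \<open>\<kappa> = cos (\<pi>/3 + \<eta>)\<close> and
\<open>m = (1 + \<kappa>) / (1 - \<kappa>)\<close>. The ellipse leaves the disc only where \<open>cos s > \<kappa>\<close>, that is, near the longer arc, and for small \<open>c\<close> it remains in \<open>K\<close> there. Since \<open>\<kappa> < 1/2\<close> means \<open>m < 3\<close>, its area exceeds \<open>\<pi>\<close>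
for small \<open>c\<close>, by \<open>stretched_ellipse_area\<close>.\<close>

lemma john_contact_gap:
  fixes K :: "(real^2) set"
  assumes convex: "convex K" and maximal: "maximal_unit_disc K"
  shows "\<exists>z. \<phi> - pi / 3 \<le> z \<and> z \<le> \<phi> + pi / 3 \<and> dir z \<in> frontier K"
proof (rule ccontr)
  have K: "convex K" "cball 0 1 \<subseteq> K" using convex maximal by (auto simp: maximal_unit_disc_def)
  assume none: "\<not> ?thesis"
  have dK: "dir z \<in> K" for z using K(2) by (intro subsetD[OF K(2)]) simp
  have int: "dir z \<in> interior K" if "\<phi> - pi / 3 \<le> z" "z \<le> \<phi> + pi / 3" for z
  proof -
    have "dir z \<notin> frontier K" using none that by blast
    then show ?thesis using dK[of z] closure_subset[of K] by (auto simp: frontier_def)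
  qed
  define I where "I = dir -` interior K"
  have "open I" unfolding I_def using continuous_dir by (intro open_vimage) auto
  then have "\<exists>e>0. \<forall>y. dist y x < e \<longrightarrow> y \<in> I" if "x \<in> I" for x using that by (auto simp: open_dist)
  moreover have "\<phi> - pi / 3 \<in> I" "\<phi> + pi / 3 \<in> I" using int by (auto simp: I_def)
  ultimately obtain e1 e2 where e: "0 < e1" "\<And>y. dist y (\<phi> - pi / 3) < e1 \<Longrightarrow> y \<in> I"
    "0 < e2" "\<And>y. dist y (\<phi> + pi / 3) < e2 \<Longrightarrow> y \<in> I" by meson
  define \<eta> where "\<eta> = min (pi / 12) (min e1 e2 / 2)"
  have \<eta>: "0 < \<eta>" "\<eta> \<le> pi / 12" "\<eta> < e1" "\<eta> < e2" using e by (auto simp: \<eta>_def min_def)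
  have J: "dir z \<in> interior K" if "\<phi> - (pi / 3 + \<eta>) \<le> z" "z \<le> \<phi> + (pi / 3 + \<eta>)" for z
  proof -
    consider "z < \<phi> - pi / 3" | "\<phi> - pi / 3 \<le> z \<and> z \<le> \<phi> + pi / 3" | "\<phi> + pi / 3 < z" by linarith
    then show ?thesis
    proof cases
      case 1 then have "z \<in> I" using that \<eta> by (intro e(2)) (auto simp: dist_real_def)
      then show ?thesis by (simp add: I_def)
    next
      case 2 then show ?thesis using int by blast
    next
      case 3 then have "z \<in> I" using that \<eta> by (intro e(4)) (auto simp: dist_real_def)
      then show ?thesis by (simp add: I_def)
    qed
  qed
  have "compact (dir ` {\<phi> - (pi / 3 + \<eta>)..\<phi> + (pi / 3 + \<eta>)})"
    by (intro compact_continuous_image continuous_dir) auto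
  moreover have "dir ` {\<phi> - (pi / 3 + \<eta>)..\<phi> + (pi / 3 + \<eta>)} \<subseteq> interior K" using J by auto
  ultimately obtain \<rho> where \<rho>: "0 < \<rho>" "(\<Union>x\<in>dir ` {\<phi> - (pi / 3 + \<eta>)..\<phi> + (pi / 3 + \<eta>)}. ball x \<rho>) \<subseteq> interior K"
    using compact_subset_open_imp_ball_epsilon_subset[OF _ open_interior] by metis
  define \<kappa> where "\<kappa> = cos (pi / 3 + \<eta>)"
  have "\<kappa> < cos (pi / 3)" unfolding \<kappa>_def using \<eta> by (intro cos_monotone_0_pi) auto
  then have k2: "\<kappa> < 1 / 2" by (simp add: cos_60)
  have k0: "0 < \<kappa>" unfolding \<kappa>_def using \<eta> by (intro cos_gt_zero) auto
  define m where "m = (1 + \<kappa>) / (1 - \<kappa>)"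
  have m: "1 < m" "m < 3" "(m + 1) * \<kappa> = m - 1" using k2 k0 by (auto simp: m_def field_simps)
  \<comment> \<open>Boundary points of the ellipse are within \<open>9 c\<close> of the circle, hence the bound \<open>\<rho> / 10\<close>; the last bound is
    for the area, and \<open>1 / 4\<close> keeps \<open>m c < 1\<close>.\<close>
  define c where "c = min (min (\<rho> / 10) (1 / 4)) ((3 - m) / (4 * m))"
  have c: "0 < c" "c \<le> \<rho> / 10" "c \<le> 1 / 4" "c \<le> (3 - m) / (4 * m)" using \<rho>(1) m by (auto simp: c_def)
  have cm: "c < (3 - m) / (3 * m)"
  proof -
    have "(3 - m) / (4 * m) < (3 - m) / (3 * m)" using m by (intro divide_strict_left_mono) auto
    then show ?thesis using c by linarith
  qed
  have mc: "m * c < 3 / 4" "0 < m * c"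
  proof -
    have "m * c \<le> m * (1 / 4)" using c m by (intro mult_left_mono) auto
    then show "m * c < 3 / 4" using m by linarith
  qed (use c m in auto)
  define b where "b = sqrt ((1 + c) * (1 - m * c))"
  have b2: "b\<^sup>2 = (1 + c) * (1 - m * c)" unfolding b_def using c mc by (intro real_sqrt_pow2) auto
  have b0: "0 < b" unfolding b_def using c mc by simp
  have b1: "\<bar>b - 1\<bar> \<le> 7 * c"
  proof -
    have "\<bar>b - 1\<bar> * 1 \<le> \<bar>b - 1\<bar> * \<bar>b + 1\<bar>" using b0 by (intro mult_left_mono) auto
    also have "\<dots> = \<bar>b\<^sup>2 - 1\<bar>" by (simp add: abs_mult[symmetric] power2_eq_square algebra_simps)
    also have "b\<^sup>2 - 1 = c - m * c - c * (m * c)" unfolding b2 by (simp add: algebra_simps)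
    also have "\<bar>c - m * c - c * (m * c)\<bar> \<le> 7 * c"
    proof -
      have "m * c \<le> 3 * c" using m c by (intro mult_right_mono) auto
      moreover have "c * (m * c) \<le> c * 1" "0 \<le> c * (m * c)" using mc c by (auto intro!: mult_left_mono)
      ultimately show ?thesis using c mc by (intro abs_leI) linarith+
    qed
    finally show ?thesis by simp
  qed
  define M :: "real^2^2" where "M = (\<chi> i j. if j = 1 then (1 + c) * dir \<phi> $ i else b * codir \<phi> $ i)"
  define d where "d = c *\<^sub>R dir \<phi>"
  have Mv: "M *v y = ((1 + c) * y $ 1) *\<^sub>R dir \<phi> + (b * y $ 2) *\<^sub>R codir \<phi>" for y
    by (simp add: M_def vec2_eq_iff matrix_vector_mult_def sum_2)
  have det: "det M = (1 + c) * b"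
  proof -
    have "det M = ((1 + c) * cos \<phi>) * (b * cos \<phi>) - (b * - sin \<phi>) * ((1 + c) * sin \<phi>)"
      by (simp add: det_2 M_def)
    also have "\<dots> = (1 + c) * b * ((cos \<phi>)\<^sup>2 + (sin \<phi>)\<^sup>2)" by algebra
    finally have "det M = (1 + c) * b * ((cos \<phi>)\<^sup>2 + (sin \<phi>)\<^sup>2)" .
    then show ?thesis by simp
  qed
  have norm_on: "(norm (p *\<^sub>R dir \<phi> + q *\<^sub>R codir \<phi>))\<^sup>2 = p\<^sup>2 + q\<^sup>2" for p q
  proof -
    have cs: "(cos \<phi>)\<^sup>2 + (sin \<phi>)\<^sup>2 = 1" by simp
    show ?thesis unfolding norm_vec2_sq using cs
      by (simp only: vector_add_component vector_scaleR_component dir_nth codir_nth real_scaleR_def) algebra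
  qed
  have bdry: "d + M *v dir s \<in> K" if s: "- pi \<le> s" "s \<le> pi" for s
  proof -
    have e: "d + M *v dir s = (c + (1 + c) * cos s) *\<^sub>R dir \<phi> + (b * sin s) *\<^sub>R codir \<phi>"
      by (simp add: d_def Mv algebra_simps)
    show ?thesis
    proof (cases "cos s \<le> \<kappa>")
      case True
      have sin2: "(sin s)\<^sup>2 = 1 - (cos s)\<^sup>2" by (simp add: sin_squared_eq)
      have "(norm (d + M *v dir s))\<^sup>2 = (c + (1 + c) * cos s)\<^sup>2 + (1 + c) * (1 - m * c) * (1 - (cos s)\<^sup>2)"
        unfolding e norm_on by (simp add: power_mult_distrib b2 sin2)
      also have "\<dots> = 1 + (cos s + 1) * ((1 + c) * c * ((m + 1) * cos s - (m - 1)))"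
        by (simp add: power2_eq_square algebra_simps)
      also have "\<dots> \<le> 1"
      proof -
        have "(m + 1) * cos s \<le> (m + 1) * \<kappa>" using True m by (intro mult_left_mono) auto
        then have "(m + 1) * cos s - (m - 1) \<le> 0" using m(3) by simp
        then have "(1 + c) * c * ((m + 1) * cos s - (m - 1)) \<le> 0" using c by (intro mult_nonneg_nonpos) auto
        then have "(cos s + 1) * ((1 + c) * c * ((m + 1) * cos s - (m - 1))) \<le> 0"
          using cos_ge_minus_one[of s] by (intro mult_nonneg_nonpos[of "cos s + 1"]; linarith)
        then show ?thesis by simp
      qed
      finally have "norm (d + M *v dir s) \<le> 1" using power2_le_imp_le[of "norm (d + M *v dir s)" 1] by simp
      then show ?thesis using K(2) by (intro subsetD[OF K(2)]) simp
    next
      case False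
      have "\<bar>s\<bar> < pi / 3 + \<eta>"
      proof (rule ccontr)
        assume "\<not> ?thesis"
        then have "cos \<bar>s\<bar> \<le> \<kappa>" unfolding \<kappa>_def using s \<eta> by (intro cos_monotone_0_pi_le) auto
        then show False using False by simp
      qed
      then have J': "\<phi> + s \<in> {\<phi> - (pi / 3 + \<eta>)..\<phi> + (pi / 3 + \<eta>)}" by auto
      have "d + M *v dir s - dir (\<phi> + s) = (c + c * cos s) *\<^sub>R dir \<phi> + ((b - 1) * sin s) *\<^sub>R codir \<phi>"
        unfolding e dir_add by (simp add: algebra_simps)
      then have "norm (d + M *v dir s - dir (\<phi> + s)) \<le> norm ((c + c * cos s) *\<^sub>R dir \<phi>) + norm (((b - 1) * sin s) *\<^sub>R codir \<phi>)"
        by (simp only: norm_triangle_ineq)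
      also have "\<dots> = \<bar>c + c * cos s\<bar> + \<bar>b - 1\<bar> * \<bar>sin s\<bar>"
        by (simp add: abs_mult)
      also have "\<dots> \<le> 2 * c + 7 * c * 1"
      proof (intro add_mono mult_mono b1 abs_sin_le_one)
        have "c * cos s \<le> c * 1" "c * - 1 \<le> c * cos s" using c by (intro mult_left_mono; simp)+
        then show "\<bar>c + c * cos s\<bar> \<le> 2 * c" using c by (simp only: abs_le_iff; intro conjI; linarith)
      qed (use c in auto)
      also have "\<dots> < \<rho>" using c \<rho>(1) by linarith
      finally have "d + M *v dir s \<in> ball (dir (\<phi> + s)) \<rho>" by (simp add: dist_norm norm_minus_commute)
      then have "d + M *v dir s \<in> interior K" using \<rho>(2) J' by blast
      then show ?thesis using interior_subset by blast
    qed
  qed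
  have "(\<lambda>x. d + M *v x) ` cball 0 1 \<subseteq> K"
  proof
    fix y assume "y \<in> (\<lambda>x. d + M *v x) ` cball 0 1"
    then obtain x where x: "norm x \<le> 1" "y = d + M *v x" by auto
    obtain r t where rt: "0 \<le> r" "0 \<le> t" "t \<le> 2 * pi" "x = r *\<^sub>R dir (- pi + t)" using polar_from by blast
    have r1: "r \<le> 1" using x(1) rt by simp
    have "d \<in> K" using c by (intro subsetD[OF K(2)]) (simp add: d_def)
    moreover have "d + M *v dir (- pi + t) \<in> K" using rt by (intro bdry) auto
    ultimately have "(1 - r) *\<^sub>R d + r *\<^sub>R (d + M *v dir (- pi + t)) \<in> K"
      using rt r1 K(1) by (intro convexD_alt) auto
    moreover have "(1 - r) *\<^sub>R d + r *\<^sub>R (d + M *v dir (- pi + t)) = y"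
      unfolding x(2) rt(4) by (simp add: matrix_vector_mult_scaleR algebra_simps)
    ultimately show "y \<in> K" by simp
  qed
  moreover have "det M \<noteq> 0" using c b0 by (simp add: det)
  ultimately have "\<bar>det M\<bar> \<le> 1" using maximal unfolding maximal_unit_disc_def by blast
  then have "(1 + c) * b \<le> 1" using c b0 by (simp add: det)
  then have "((1 + c) * b)\<^sup>2 \<le> 1" using c b0 by (intro power_le_one) auto
  moreover have "((1 + c) * b)\<^sup>2 = (1 + c) ^ 3 * (1 - m * c)"
    unfolding power_mult_distrib b2 by (simp add: power3_eq_cube power2_eq_square)
  ultimately show False using stretched_ellipse_area[OF c(1) _ m(2) cm] m by simp
qed

section \<open>Estimates for the tangent function\<close>

lemma convex_on_tan:
  assumes "b < pi / 2"
  shows "convex_on {0..b} tan"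
proof (rule convex_on_realI[where f' = "\<lambda>x. inverse ((cos x)\<^sup>2)"])
  have c: "0 < cos x" if "x \<in> {0..b}" for x using that assms by (intro cos_gt_zero_pi) auto
  show "(tan has_real_derivative inverse ((cos x)\<^sup>2)) (at x)" if "x \<in> {0..b}" for x
    using c[OF that] by (intro DERIV_tan) auto
  show "inverse ((cos x)\<^sup>2) \<le> inverse ((cos y)\<^sup>2)" if "x \<in> {0..b}" "y \<in> {0..b}" "x \<le> y" for x y
  proof -
    have "cos y \<le> cos x" using that assms by (intro cos_monotone_0_pi_le) auto
    then show ?thesis using c[of y] that by (intro le_imp_inverse_le power_mono) auto
  qed
qed auto

text \<open>The right side is the chord of the convex function \<open>tan\<close> over \<open>[0, \<pi>/6]\<close>.\<close>

lemma tan_le_chord: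
  assumes "0 \<le> h" "h \<le> pi / 6"
  shows "tan h \<le> 2 * sqrt 3 / pi * h"
proof -
  have "tan h \<le> (tan (pi / 6) - tan 0) / (pi / 6 - 0) * (h - 0) + tan 0"
    using assms by (intro convex_onD_Icc' convex_on_tan) auto
  also have "\<dots> = 2 * sqrt 3 / pi * h"
    by (simp add: tan_30 field_simps)
  finally show ?thesis .
qed

text \<open>By convexity \<open>tan\<close> lies below its chords over \<open>[0, \<pi>/6]\<close> and \<open>[\<pi>/6, \<pi>/3]\<close>. The chord over
\<open>[0, \<pi>/3]\<close> has slope \<open>3 \<surd>3 / \<pi>\<close>, and the short chords fall below it at the rate \<open>\<surd>3 / \<pi>\<close> from
either end.\<close>

lemma tan_deficit:
  assumes "0 \<le> h" "h \<le> pi / 3"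
  shows "tan h + sqrt 3 / pi * min h (pi / 3 - h) \<le> 3 * sqrt 3 / pi * h"
proof (cases "h \<le> pi / 6")
  case True
  then show ?thesis using tan_le_chord[OF assms(1) True] by (simp add: min_def field_simps)
next
  case False
  have "convex_on {pi / 6..pi / 3} tan"
    by (rule convex_on_subset[OF convex_on_tan[of "pi / 3"]]) auto
  then have "tan h \<le> (tan (pi / 6) - tan (pi / 3)) / (pi / 3 - pi / 6) * (pi / 3 - h) + tan (pi / 3)"
    using assms False by (intro convex_onD_Icc'') auto
  also have "(tan (pi / 6) - tan (pi / 3)) / (pi / 3 - pi / 6) = - (4 * sqrt 3 / pi)"
    by (simp add: tan_30 tan_60 field_simps)
  finally have "tan h \<le> - (4 * sqrt 3 / pi) * (pi / 3 - h) + sqrt 3" by (simp add: tan_60)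
  also have "\<dots> = 3 * sqrt 3 / pi * h - sqrt 3 / pi * (pi / 3 - h)" by (simp add: field_simps)
  finally show ?thesis using False by (simp add: min_def)
qed

text \<open>Addition theorem, with \<open>tan \<delta> \<le> 6 \<surd>3 x\<close> from \<open>tan_le_chord\<close>.\<close>

lemma tan_near_60:
  assumes "0 \<le> x" "x \<le> 1 / 100" "0 \<le> \<delta>" "\<delta> \<le> 3 * pi * x"
  shows "tan (pi / 3 + \<delta>) \<le> sqrt 3 * (1 + 6 * x) / (1 - 18 * x)"
proof -
  have "\<delta> \<le> 3 * pi * (1 / 100)" using assms by (meson mult_left_mono order_trans pi_ge_zero mult_nonneg_nonneg zero_le_numeral)
  then have d: "\<delta> \<le> pi / 6" "\<delta> < pi / 6" using pi_gt_zero by linarith+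
  have "tan \<delta> \<le> 2 * sqrt 3 / pi * \<delta>" using assms d by (intro tan_le_chord) auto
  also have "\<dots> \<le> 2 * sqrt 3 / pi * (3 * pi * x)" using assms by (intro mult_left_mono) auto
  finally have t: "tan \<delta> \<le> 6 * sqrt 3 * x" by simp
  have t0: "0 \<le> tan \<delta>" using assms d pi_gt_zero by (intro tan_pos_pi2_le) linarith+
  have "sqrt 3 * tan \<delta> \<le> sqrt 3 * (6 * sqrt 3 * x)" using t by (intro mult_left_mono) auto
  also have "\<dots> = 6 * (sqrt 3 * sqrt 3) * x" by (simp only: mult_ac)
  finally have s: "sqrt 3 * tan \<delta> \<le> 18 * x" by simp
  have cos: "cos (pi / 3) \<noteq> 0" "cos \<delta> \<noteq> 0" "cos (pi / 3 + \<delta>) \<noteq> 0"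
    using cos_gt_zero_pi[of "pi / 3"] cos_gt_zero_pi[of \<delta>] cos_gt_zero_pi[of "pi / 3 + \<delta>"] assms d pi_gt_zero
    by auto
  have "tan (pi / 3 + \<delta>) = (sqrt 3 + tan \<delta>) / (1 - sqrt 3 * tan \<delta>)"
    by (subst tan_add[OF cos]) (simp add: tan_60)
  also have "\<dots> \<le> (sqrt 3 * (1 + 6 * x)) / (1 - 18 * x)"
    using t s t0 assms by (intro frac_le) (auto simp: algebra_simps)
  finally show ?thesis .
qed

section \<open>Stability of the area bound\<close>

text \<open>The interval from \<open>t0\<close> to \<open>t0 + 6 g\<close> is cut at \<open>t0 + 2 g\<close> and \<open>t0 + 4 g\<close>, and for each cut the nearest points of \<open>Z\<close> on
either side are chosen. No point of \<open>Z\<close> lies strictly between these two, so they are at most \<open>2 g\<close> apart.\<close>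

lemma five_points_with_small_gaps:
  fixes Z :: "real set"
  assumes Z: "closed Z" and gap: "\<And>x. \<exists>z\<in>Z. x \<le> z \<and> z \<le> x + 2 * g"
    and t0: "0 < g" "t0 \<in> Z" "t0 + 6 * g \<in> Z"
  obtains t1 t2 t3 t4 where "t1 \<in> Z" "t2 \<in> Z" "t3 \<in> Z" "t4 \<in> Z"
    "t0 \<le> t1" "t1 \<le> t0 + 2 * g" "t0 + 2 * g \<le> t2" "t2 \<le> t3" "t3 \<le> t0 + 4 * g" "t0 + 4 * g \<le> t4"
    "t4 \<le> t0 + 6 * g" "t2 - t1 \<le> 2 * g" "t4 - t3 \<le> 2 * g"
proof -
  have cpt: "compact (Z \<inter> {x..y})" for x y
    using Z by (intro closed_Int_compact) auto
  have ne1: "Z \<inter> {t0..t0 + 2 * g} \<noteq> {}" using gap[of t0] by auto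
  have ne2: "Z \<inter> {t0 + 2 * g..t0 + 4 * g} \<noteq> {}" using gap[of "t0 + 2 * g"] by auto
  have ne3: "Z \<inter> {t0 + 4 * g..t0 + 6 * g} \<noteq> {}" using gap[of "t0 + 4 * g"] by auto
  obtain t1 where t1: "t1 \<in> Z \<inter> {t0..t0 + 2 * g}" "\<And>z. z \<in> Z \<inter> {t0..t0 + 2 * g} \<Longrightarrow> z \<le> t1"
    using compact_attains_sup[OF cpt ne1] by blast
  obtain t2 where t2: "t2 \<in> Z \<inter> {t0 + 2 * g..t0 + 4 * g}" "\<And>z. z \<in> Z \<inter> {t0 + 2 * g..t0 + 4 * g} \<Longrightarrow> t2 \<le> z"
    using compact_attains_inf[OF cpt ne2] by blast
  obtain t3 where t3: "t3 \<in> Z \<inter> {t0 + 2 * g..t0 + 4 * g}" "\<And>z. z \<in> Z \<inter> {t0 + 2 * g..t0 + 4 * g} \<Longrightarrow> z \<le> t3"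
    using compact_attains_sup[OF cpt ne2] by blast
  obtain t4 where t4: "t4 \<in> Z \<inter> {t0 + 4 * g..t0 + 6 * g}" "\<And>z. z \<in> Z \<inter> {t0 + 4 * g..t0 + 6 * g} \<Longrightarrow> t4 \<le> z"
    using compact_attains_inf[OF cpt ne3] by blast
  have between: "v - u \<le> 2 * g" if no: "\<And>z. z \<in> Z \<Longrightarrow> u < z \<Longrightarrow> z < v \<Longrightarrow> False" for u v
  proof (rule ccontr)
    assume *: "\<not> ?thesis"
    obtain z where "z \<in> Z" "(u + v) / 2 - g \<le> z" "z \<le> (u + v) / 2 - g + 2 * g" using gap by blast
    then show False using no[of z] * by (simp add: field_simps)
  qed
  have "t2 - t1 \<le> 2 * g"
  proof (rule between)
    fix z assume z: "z \<in> Z" "t1 < z" "z < t2"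
    show False using z t1(1) t2(1) t1(2)[of z] t2(2)[of z] by (cases "z \<le> t0 + 2 * g") auto
  qed
  moreover have "t4 - t3 \<le> 2 * g"
  proof (rule between)
    fix z assume z: "z \<in> Z" "t3 < z" "z < t4"
    show False using z t3(1) t4(1) t3(2)[of z] t4(2)[of z] by (cases "z \<le> t0 + 4 * g") auto
  qed
  ultimately show ?thesis using that[of t1 t2 t3 t4] t1(1) t2 t3(1) t4(1) by auto
qed

text \<open>When \<open>x\<close> and \<open>y\<close> are close to 0 or \<open>g\<close> and \<open>x + y \<ge> g\<close>, one of the partial sums \<open>x\<close>, \<open>x + y\<close> is close to
\<open>g\<close>. This selects the contact points of the nearly regular triangle.\<close>

lemma nearly_full_partial_sum:
  fixes x y g :: real
  assumes "0 \<le> x" "x \<le> g" "0 \<le> y" "y \<le> g" "g \<le> x + y"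
  shows "\<bar>x - g\<bar> \<le> min x (g - x) + min y (g - y) \<or> \<bar>x + y - g\<bar> \<le> min x (g - x) + min y (g - y)"
  using assms by (auto simp: min_def abs_if)

text \<open>With \<open>m h = min h (\<pi>/3 - h)\<close>, the bound of the area by \<open>\<Sum> tan h\<^sub>i\<close> and \<open>tan_deficit\<close> give \<open>\<Sum> m h\<^sub>i \<le> \<delta>\<close>. The first contact
angle \<open>t0\<close> is kept, and one of \<open>t1, t2\<close> and one of \<open>t3, t4\<close> are close to \<open>t0 + 2\<pi>/3\<close> and
\<open>t0 + 4\<pi>/3\<close>. The half-angles between these three differ from \<open>\<pi>/3\<close> by at most \<open>\<delta>\<close>.\<close>

lemma john_disc_near_triangle:
  fixes K :: "(real^2) set"
  assumes K: "compact K" "convex K" "maximal_unit_disc K"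
  defines "\<delta> \<equiv> pi / sqrt 3 * (3 * sqrt 3 - area K)"
  shows "0 \<le> \<delta>"
    and "\<delta> < pi / 6 \<Longrightarrow> \<exists>p q r. K \<subseteq> convex hull {p, q, r} \<and> area (convex hull {p, q, r}) \<le> 3 * tan (pi / 3 + \<delta>)"
proof -
  define Z where "Z = dir -` frontier K"
  have Z: "closed Z" unfolding Z_def using continuous_dir by (intro closed_vimage) auto
  have gap: "\<exists>z\<in>Z. x \<le> z \<and> z \<le> x + 2 * (pi / 3)" for x
    using john_contact_gap[OF K(2,3), of "x + pi / 3"] by (auto simp: Z_def)
  obtain t0 where t0: "t0 \<in> Z" using gap by blast
  have t6: "t0 + 6 * (pi / 3) \<in> Z" using t0 dir_periodic[of t0] by (simp add: Z_def)
  obtain t1 t2 t3 t4 where tZ: "t1 \<in> Z" "t2 \<in> Z" "t3 \<in> Z" "t4 \<in> Z"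
    and t: "t0 \<le> t1" "t1 \<le> t0 + 2 * (pi / 3)" "t0 + 2 * (pi / 3) \<le> t2" "t2 \<le> t3" "t3 \<le> t0 + 4 * (pi / 3)"
    "t0 + 4 * (pi / 3) \<le> t4" "t4 \<le> t0 + 6 * (pi / 3)" "t2 - t1 \<le> 2 * (pi / 3)" "t4 - t3 \<le> 2 * (pi / 3)"
    by (rule five_points_with_small_gaps[OF Z gap _ t0 t6]) simp
  define h0 h1 h2 h3 h4 where hs: "h0 = (t1 - t0) / 2" "h1 = (t2 - t1) / 2" "h2 = (t3 - t2) / 2"
    "h3 = (t4 - t3) / 2" "h4 = (t0 + 2 * pi - t4) / 2"
  have hb: "0 \<le> h0 \<and> h0 \<le> pi / 3" "0 \<le> h1 \<and> h1 \<le> pi / 3" "0 \<le> h2 \<and> h2 \<le> pi / 3"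
    "0 \<le> h3 \<and> h3 \<le> pi / 3" "0 \<le> h4 \<and> h4 \<le> pi / 3" using t unfolding hs by auto
  have hsum: "h0 + h1 + h2 + h3 + h4 = pi" unfolding hs by (simp add: field_simps)
  define m where "m h = min h (pi / 3 - h)" for h
  have m0: "0 \<le> m h" if "0 \<le> h \<and> h \<le> pi / 3" for h using that by (auto simp: m_def)
  have tangent: "x \<bullet> dir z \<le> 1" if "z \<in> Z" "x \<in> K" for z x
    using contact_tangent[OF K(2)] K(3) that by (auto simp: Z_def maximal_unit_disc_def)
  have sum_tan: "area K \<le> tan h0 + tan h1 + tan h2 + tan h3 + tan h4"
  proof -
    define \<psi> where "\<psi> = (!) [t0, t1, t2, t3, t4, t0 + 2 * pi]"
    define k where "k = (!) [h0, h1, h2, h3, h4]"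
    have v: "\<psi> 0 = t0" "\<psi> 1 = t1" "\<psi> 2 = t2" "\<psi> 3 = t3" "\<psi> 4 = t4" "\<psi> 5 = t0 + 2 * pi"
      "k 0 = h0" "k 1 = h1" "k 2 = h2" "k 3 = h3" "k 4 = h4" by (simp_all add: \<psi>_def k_def)
    have suc: "Suc 0 = 1" "Suc 1 = 2" "Suc 2 = 3" "Suc 3 = 4" "Suc 4 = 5" by auto
    have lt5: "i < 5 \<longleftrightarrow> i = 0 \<or> i = 1 \<or> i = 2 \<or> i = 3 \<or> i = 4"
      "i \<le> 5 \<longleftrightarrow> i = 0 \<or> i = 1 \<or> i = 2 \<or> i = 3 \<or> i = 4 \<or> i = 5" for i :: nat by auto
    have lt2: "h < pi / 2" if "0 \<le> h \<and> h \<le> pi / 3" for h using that pi_gt_zero by linarith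
    have step: "t1 = t0 + 2 * h0" "t2 = t1 + 2 * h1" "t3 = t2 + 2 * h2" "t4 = t3 + 2 * h3"
      "t0 + 2 * pi = t4 + 2 * h4" by (simp_all add: hs field_simps)
    have each:
      "0 \<le> k 0 \<and> k 0 < pi / 2 \<and> \<psi> (Suc 0) = \<psi> 0 + 2 * k 0"
      "0 \<le> k 1 \<and> k 1 < pi / 2 \<and> \<psi> (Suc 1) = \<psi> 1 + 2 * k 1"
      "0 \<le> k 2 \<and> k 2 < pi / 2 \<and> \<psi> (Suc 2) = \<psi> 2 + 2 * k 2"
      "0 \<le> k 3 \<and> k 3 < pi / 2 \<and> \<psi> (Suc 3) = \<psi> 3 + 2 * k 3"
      "0 \<le> k 4 \<and> k 4 < pi / 2 \<and> \<psi> (Suc 4) = \<psi> 4 + 2 * k 4"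
      unfolding suc v using hb lt2 step by blast+
    have "area K \<le> (\<Sum>i<5. tan (k i))"
    proof (rule area_le_sum_tan[where \<psi> = \<psi>, OF K(1)])
      fix i x assume "i \<le> (5::nat)" "x \<in> K"
      then show "x \<bullet> dir (\<psi> i) \<le> 1" using tangent[OF t0] tangent[OF tZ(1)] tangent[OF tZ(2)] tangent[OF tZ(3)] tangent[OF tZ(4)]
        unfolding lt5 by (elim disjE) (simp_all only: v dir_periodic)
    next
      fix i assume "i < (5::nat)"
      then show "0 \<le> k i \<and> k i < pi / 2 \<and> \<psi> (Suc i) = \<psi> i + 2 * k i"
        using each unfolding lt5 by blast
    qed (simp add: v)
    also have "(\<Sum>i<5. tan (k i)) = tan h0 + tan h1 + tan h2 + tan h3 + tan h4"
      by (simp add: eval_nat_numeral k_def)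
    finally show ?thesis .
  qed
  have tan_le: "tan h \<le> 3 * sqrt 3 / pi * h - sqrt 3 / pi * m h" if "0 \<le> h \<and> h \<le> pi / 3" for h
    using tan_deficit[of h] that by (simp add: m_def)
  have collect: "s \<le> A * (h0 + h1 + h2 + h3 + h4) - B * (m h0 + m h1 + m h2 + m h3 + m h4)"
    if "s \<le> tan h0 + tan h1 + tan h2 + tan h3 + tan h4"
      "\<And>h. 0 \<le> h \<and> h \<le> pi / 3 \<Longrightarrow> tan h \<le> A * h - B * m h" for A B s
    using that(1) that(2)[OF hb(1)] that(2)[OF hb(2)] that(2)[OF hb(3)] that(2)[OF hb(4)] that(2)[OF hb(5)]
    unfolding distrib_left by linarith
  have "area K \<le> 3 * sqrt 3 / pi * (h0 + h1 + h2 + h3 + h4) - sqrt 3 / pi * (m h0 + m h1 + m h2 + m h3 + m h4)"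
    by (rule collect[OF sum_tan tan_le])
  then have "sqrt 3 / pi * (m h0 + m h1 + m h2 + m h3 + m h4) \<le> 3 * sqrt 3 - area K"
    unfolding hsum by simp
  then have "(pi / sqrt 3) * (sqrt 3 / pi * (m h0 + m h1 + m h2 + m h3 + m h4)) \<le> \<delta>"
    unfolding \<delta>_def by (intro mult_left_mono) auto
  then have md: "m h0 + m h1 + m h2 + m h3 + m h4 \<le> \<delta>" by simp
  then show "0 \<le> \<delta>" using m0[OF hb(1)] m0[OF hb(2)] m0[OF hb(3)] m0[OF hb(4)] m0[OF hb(5)] by linarith
  assume d6: "\<delta> < pi / 6"
  have "pi / 3 \<le> h0 + h1" "pi / 3 \<le> h4 + h3" using t unfolding hs by (auto simp: field_simps)
  then have "\<bar>h0 - pi / 3\<bar> \<le> m h0 + m h1 \<or> \<bar>h0 + h1 - pi / 3\<bar> \<le> m h0 + m h1"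
    "\<bar>h4 - pi / 3\<bar> \<le> m h4 + m h3 \<or> \<bar>h4 + h3 - pi / 3\<bar> \<le> m h4 + m h3"
    unfolding m_def using hb by (intro nearly_full_partial_sum; simp)+
  moreover have "h0 + h1 = (t2 - t0) / 2" "h4 + h3 = (t0 + 2 * pi - t3) / 2" by (simp_all add: hs field_simps)
  ultimately obtain b c where b: "b \<in> {t1, t2}" "\<bar>(b - t0) / 2 - pi / 3\<bar> \<le> m h0 + m h1"
    and c: "c \<in> {t3, t4}" "\<bar>(t0 + 2 * pi - c) / 2 - pi / 3\<bar> \<le> m h4 + m h3"
    unfolding hs(1) hs(5) by (metis insert_iff)
  define u v w where uvw: "u = (b - t0) / 2" "v = (c - b) / 2" "w = (t0 + 2 * pi - c) / 2"
  have sum: "u + v + w = pi" unfolding uvw by (simp add: field_simps)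
  have near: "\<bar>u - pi / 3\<bar> \<le> \<delta>" "\<bar>v - pi / 3\<bar> \<le> \<delta>" "\<bar>w - pi / 3\<bar> \<le> \<delta>"
  proof -
    have "\<bar>u - pi / 3\<bar> + \<bar>w - pi / 3\<bar> \<le> \<delta>" using b(2) c(2) md m0[OF hb(3)] unfolding uvw by linarith
    then show "\<bar>u - pi / 3\<bar> \<le> \<delta>" "\<bar>v - pi / 3\<bar> \<le> \<delta>" "\<bar>w - pi / 3\<bar> \<le> \<delta>" using sum by linarith+
  qed
  have rng: "0 < u" "u < pi / 2" "0 < v" "v < pi / 2" "0 < w" "w < pi / 2"
    using near d6 pi_gt_zero by linarith+
  have bc: "b = t0 + 2 * u" "c = b + 2 * v" by (simp_all add: uvw field_simps)
  note tri = tangent_triangle[OF rng sum bc]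
  have tl: "tan x \<le> tan (pi / 3 + \<delta>)" if "\<bar>x - pi / 3\<bar> \<le> \<delta>" for x
    using that d6 pi_gt_zero by (intro tan_mono_le) linarith+
  have "area (convex hull {tangent_vertex t0 u, tangent_vertex b v, tangent_vertex c w}) \<le> 3 * tan (pi / 3 + \<delta>)"
    using tri(1) tl[OF near(1)] tl[OF near(2)] tl[OF near(3)] by linarith
  moreover have "K \<subseteq> convex hull {tangent_vertex t0 u, tangent_vertex b v, tangent_vertex c w}"
    using tangent t0 tZ b(1) c(1) by (intro subsetI tri(2)) auto
  ultimately show "\<exists>p q r. K \<subseteq> convex hull {p, q, r} \<and> area (convex hull {p, q, r}) \<le> 3 * tan (pi / 3 + \<delta>)"
    by blast
qed

text \<open>Here \<open>\<delta> < 3 \<pi> x\<close>. The area of the triangle is at most \<open>3 \<surd>3 (1 + 6 x) / (1 - 18 x)\<close>, and the quotient by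
\<open>(1 - x) 3 \<surd>3\<close> is at most \<open>1 + 30 x\<close> for small \<open>x\<close>.\<close>

lemma john_disc_stability:
  fixes K :: "(real^2) set"
  assumes K: "compact K" "convex K" "maximal_unit_disc K"
    and x: "0 \<le> x" "x \<le> 1 / 1000" and large: "(1 - x) * (3 * sqrt 3) < area K"
  shows "0 < x"
    and "\<exists>p q r. K \<subseteq> convex hull {p, q, r} \<and> area (convex hull {p, q, r}) \<le> (1 + 30 * x) * area K"
proof -
  define \<delta> where "\<delta> = pi / sqrt 3 * (3 * sqrt 3 - area K)"
  have "\<delta> < pi / sqrt 3 * (x * (3 * sqrt 3))"
    unfolding \<delta>_def using large by (intro mult_strict_left_mono) (auto simp: algebra_simps)
  then have d: "\<delta> < 3 * pi * x" by simp
  have d0: "0 \<le> \<delta>" unfolding \<delta>_def by (rule john_disc_near_triangle(1)[OF K])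
  have "0 < 3 * pi * x" using d d0 by linarith
  then show "0 < x" by (simp add: zero_less_mult_iff)
  have "3 * pi * x \<le> 3 * pi * (1 / 1000)" using x by (intro mult_left_mono) auto
  then have "\<delta> < pi / 6" using d pi_gt_zero by linarith
  then obtain p q r where tri: "K \<subseteq> convex hull {p, q, r}" "area (convex hull {p, q, r}) \<le> 3 * tan (pi / 3 + \<delta>)"
    using john_disc_near_triangle(2)[OF K, folded \<delta>_def] by blast
  have "area (convex hull {p, q, r}) \<le> 3 * (sqrt 3 * (1 + 6 * x) / (1 - 18 * x))"
    using tri(2) tan_near_60[of x \<delta>] x d d0 by simp
  also have "\<dots> \<le> (1 + 30 * x) * ((1 - x) * (3 * sqrt 3))"
  proof -
    have "x * x \<le> x * (1 / 1000)" using x by (intro mult_left_mono) auto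
    then have "1 + 6 * x \<le> (1 + 30 * x) * (1 - 19 * x)" using x by (simp add: algebra_simps)
    also have "\<dots> \<le> (1 + 30 * x) * ((1 - x) * (1 - 18 * x))"
      using x by (intro mult_left_mono) (auto simp: algebra_simps)
    finally have "(3 * sqrt 3) * (1 + 6 * x) \<le> (3 * sqrt 3) * ((1 + 30 * x) * ((1 - x) * (1 - 18 * x)))"
      by (intro mult_left_mono) auto
    also have "\<dots> = (1 + 30 * x) * ((1 - x) * (3 * sqrt 3)) * (1 - 18 * x)" by (simp only: mult_ac)
    finally have "(3 * sqrt 3) * (1 + 6 * x) / (1 - 18 * x) \<le> (1 + 30 * x) * ((1 - x) * (3 * sqrt 3))"
      using x by (subst pos_divide_le_eq) auto
    then show ?thesis by (simp only: times_divide_eq_right mult.assoc)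
  qed
  also have "\<dots> \<le> (1 + 30 * x) * area K" using large x by (intro mult_left_mono) auto
  finally show "\<exists>p q r. K \<subseteq> convex hull {p, q, r} \<and> area (convex hull {p, q, r}) \<le> (1 + 30 * x) * area K"
    using tri(1) by blast
qed

section \<open>Normalization of the John ball\<close>

lemma cball_as_scaled_unit_disc:
  assumes "0 < r"
  shows "cball (c::real^2) r = (\<lambda>x. r *\<^sub>R x + c) ` cball 0 1"
proof
  show "cball c r \<subseteq> (\<lambda>x. r *\<^sub>R x + c) ` cball 0 1"
  proof
    fix x assume "x \<in> cball c r"
    then have "x = r *\<^sub>R ((1 / r) *\<^sub>R (x - c)) + c" "(1 / r) *\<^sub>R (x - c) \<in> cball 0 1"
      using assms by (auto simp: dist_norm norm_minus_commute)
    then show "x \<in> (\<lambda>x. r *\<^sub>R x + c) ` cball 0 1" by blast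
  qed
  show "(\<lambda>x. r *\<^sub>R x + c) ` cball 0 1 \<subseteq> cball c r"
    using assms by (auto simp: dist_norm mult_left_le)
qed

lemma area_ellipse:
  fixes A :: "real^2^2"
  shows "area ((\<lambda>x. c + A *v x) ` cball 0 1) = \<bar>det A\<bar> * area (cball (0::real^2) 1)"
proof -
  have "(\<lambda>x. c + A *v x) ` cball 0 1 = (+) c ` (\<lambda>x. A *v x) ` cball 0 1" by (simp add: image_image)
  then show ?thesis
    by (simp only: measure_translation area_matrix_image[OF lmeasurable_cball])
qed

lemma unit_disc_area_pos: "0 < area (cball (0::real^2) 1)"
  by (subst area_pos_iff) (auto simp: interior_cball)

text \<open>Ellipsoids are non-degenerate, and so have positive area.\<close>

lemma john_ball_radius_pos:
  assumes "is_john_ellipsoid (cball c r) K"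
  shows "0 < r"
proof (rule ccontr)
  assume "\<not> 0 < r"
  then have "cball c r \<subseteq> closed_segment c c" by (cases "r = 0") auto
  then have "area (cball c r) \<le> area (closed_segment c c)"
    by (intro measure_mono_fmeasurable) (auto simp: lmeasurable_compact)
  then have "area (cball c r) \<le> 0" by (simp only: area_segment)
  moreover obtain A :: "real^2^2" and d where "invertible A" "cball c r = (\<lambda>x. d + A *v x) ` cball 0 1"
    using assms unfolding is_john_ellipsoid_def ellipsoid_def by blast
  then have "0 < area (cball c r)" using unit_disc_area_pos by (simp add: area_ellipse invertible_det_nz)
  ultimately show False by linarith
qed

text \<open>The similarity that takes the unit disc to \<open>cball c r\<close> multiplies all areas by \<open>r\<^sup>2\<close>, and so preserves maximality.\<close>

lemma john_ball_normalized:
  fixes K :: "(real^2) set"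
  assumes j: "is_john_ellipsoid (cball c r) K" and M: "det (M::real^2^2) \<noteq> 0"
    and sub: "(\<lambda>x. r *\<^sub>R (d + M *v x) + c) ` cball 0 1 \<subseteq> K"
  shows "\<bar>det M\<bar> \<le> 1"
proof -
  have r: "0 < r" by (rule john_ball_radius_pos[OF j])
  define N :: "real^2^2" where "N = (\<chi> i j. r * M $ i $ j)"
  have Nv: "N *v x = r *\<^sub>R (M *v x)" for x
    by (simp add: N_def vec2_eq_iff matrix_vector_mult_def sum_2 algebra_simps)
  have detN: "det N = r\<^sup>2 * det M" by (simp add: N_def det_2 power2_eq_square algebra_simps)
  have eq: "(\<lambda>x. (r *\<^sub>R d + c) + N *v x) = (\<lambda>x. r *\<^sub>R (d + M *v x) + c)"
    by (simp add: Nv fun_eq_iff algebra_simps)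
  have "ellipsoid ((\<lambda>x. (r *\<^sub>R d + c) + N *v x) ` cball 0 1)"
    unfolding ellipsoid_def using M r detN by (metis invertible_det_nz mult_eq_0_iff power_not_zero less_irrefl)
  then have "area ((\<lambda>x. (r *\<^sub>R d + c) + N *v x) ` cball 0 1) \<le> area (cball c r)"
    using j sub unfolding is_john_ellipsoid_def eq by (elim conjE allE impE) auto
  then have "\<bar>det N\<bar> * area (cball (0::real^2) 1) \<le> r\<^sup>2 * area (cball (0::real^2) 1)"
    unfolding area_ellipse cball_as_scaled_unit_disc[OF r] area_affine_image .
  then have "\<bar>det N\<bar> \<le> r\<^sup>2" using unit_disc_area_pos by (rule mult_right_le_imp_le)
  then have "r\<^sup>2 * \<bar>det M\<bar> \<le> r\<^sup>2 * 1" by (simp add: detN abs_mult)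
  then show ?thesis using r by simp
qed

lemma john_ball_stability:
  fixes K :: "(real^2) set"
  assumes K: "convex_body K" and j: "is_john_ellipsoid (cball c r) K"
    and x: "0 \<le> x" "x \<le> 1 / 1000" and large: "(1 - x) * (3 * sqrt 3) * r\<^sup>2 < area K"
  shows "0 < x"
    and "\<exists>p q s. K \<subseteq> convex hull {p, q, s} \<and> area (convex hull {p, q, s}) \<le> (1 + 30 * x) * area K"
proof -
  have r: "0 < r" by (rule john_ball_radius_pos[OF j])
  define f where "f y = r *\<^sub>R y + c" for y
  define K' where "K' = (\<lambda>y. (1 / r) *\<^sub>R y + - ((1 / r) *\<^sub>R c)) ` K"
  have inv: "f ((1 / r) *\<^sub>R y + - ((1 / r) *\<^sub>R c)) = y" "(1 / r) *\<^sub>R f y + - ((1 / r) *\<^sub>R c) = y" for y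
    using r by (simp_all add: f_def scaleR_add_right scaleR_diff_right)
  have fK: "f ` K' = K" unfolding K'_def image_image inv by simp
  have K'I: "y \<in> K'" if "f y \<in> K" for y using that inv(2) unfolding K'_def by (metis imageI)
  have "K' = (\<lambda>y. - ((1 / r) *\<^sub>R c) + (1 / r) *\<^sub>R y) ` K" unfolding K'_def by (simp only: add.commute)
  moreover have "compact K" "convex K" using K by (auto simp: convex_body_def)
  ultimately have cK': "compact K'" "convex K'"
    by (simp_all only: compact_affinity convex_affinity)
  have "cball 0 1 \<subseteq> K'"
  proof
    fix y :: "real^2" assume "y \<in> cball 0 1"
    then have "f y \<in> cball c r" unfolding cball_as_scaled_unit_disc[OF r] f_def by blast
    then show "y \<in> K'" using j by (intro K'I) (auto simp: is_john_ellipsoid_def)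
  qed
  moreover have "\<bar>det M\<bar> \<le> 1" if "det M \<noteq> 0" "(\<lambda>x. d + M *v x) ` cball 0 1 \<subseteq> K'" for M :: "real^2^2" and d
  proof (rule john_ball_normalized[OF j that(1)])
    show "(\<lambda>x. r *\<^sub>R (d + M *v x) + c) ` cball 0 1 \<subseteq> K"
      using that(2) fK unfolding f_def by blast
  qed
  ultimately have max: "maximal_unit_disc K'" unfolding maximal_unit_disc_def by blast
  have aK: "area K = r\<^sup>2 * area K'" unfolding fK[symmetric] f_def area_affine_image ..
  have "(1 - x) * (3 * sqrt 3) < area K'" 
  proof -
    have "r\<^sup>2 * ((1 - x) * (3 * sqrt 3)) < r\<^sup>2 * area K'" using large aK by (simp only: mult.commute)
    then show ?thesis using r by simp
  qed
  note st = john_disc_stability[OF cK' max x this]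
  show "0 < x" by (rule st(1))
  obtain p q s where tri: "K' \<subseteq> convex hull {p, q, s}" "area (convex hull {p, q, s}) \<le> (1 + 30 * x) * area K'"
    using st(2) by blast
  have hull: "convex hull {f p, f q, f s} = f ` (convex hull {p, q, s})"
    using convex_hull_affinity[of c r "{p, q, s}"] by (simp add: f_def add.commute)
  have "K \<subseteq> convex hull {f p, f q, f s}" unfolding hull fK[symmetric] using tri(1) by (rule image_mono)
  moreover have "area (convex hull {f p, f q, f s}) \<le> (1 + 30 * x) * area K"
    unfolding hull unfolding aK f_def area_affine_image
    using mult_left_mono[OF tri(2), of "r\<^sup>2"] by (simp add: mult_ac)
  ultimately show "\<exists>p q s. K \<subseteq> convex hull {p, q, s} \<and> area (convex hull {p, q, s}) \<le> (1 + 30 * x) * area K"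
    by blast
qed

section \<open>The stability theorem\<close>

theorem theorem1p2:
  fixes K T :: "(real^2) set" and \<epsilon> :: real
  assumes "convex_body K"
    and "\<exists>c r. is_john_ellipsoid (cball c r) K"
    and "circumscribed_regular_triangle T"
    and "0 \<le> \<epsilon>" and "\<epsilon> < 1"
    and "delta_vol K T \<ge> \<epsilon>"
  shows "(perimeter K)\<^sup>2 / area K
           \<le> (1 - 1 / (2 ^ 10 * 3 ^ 2) * \<epsilon>) * ((perimeter T)\<^sup>2 / area T)"
proof -
  define x where "x = 1 / (2 ^ 10 * 3 ^ 2) * \<epsilon>"
  have x: "0 \<le> x" "x \<le> 1 / 1000" "60 * x \<le> \<epsilon> / 2" using assms(4,5) by (auto simp: x_def)
  obtain c r where j: "is_john_ellipsoid (cball c r) K" using assms(2) by blast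
  have r: "0 < r" by (rule john_ball_radius_pos[OF j])
  obtain a b d where tri: "a \<noteq> b" "dist a b = dist b d" "dist b d = dist d a" "T = convex hull {a, b, d}"
    using assms(3) unfolding circumscribed_regular_triangle_def by blast
  have aK: "0 < area K" using assms(1) area_pos_iff[of K] by (auto simp: convex_body_def)
  \<comment> \<open>Otherwise a triangle of area at most \<open>(1 + 30 x) V(K)\<close> contains \<open>K\<close>, and \<open>\<delta>\<^sub>v\<^sub>o\<^sub>l(K, T) \<le> 60 x < \<epsilon>\<close>. For \<open>\<epsilon> = 0\<close> the
    area of \<open>K\<close> cannot exceed \<open>3 \<surd>3 r\<^sup>2\<close>.\<close>
  have small: "area K \<le> (1 - x) * (3 * sqrt 3) * r\<^sup>2"
  proof (rule ccontr)
    assume "\<not> ?thesis"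
    then have large: "(1 - x) * (3 * sqrt 3) * r\<^sup>2 < area K" by simp
    note st = john_ball_stability[OF assms(1) j x(1,2) large]
    obtain p q s where hull: "K \<subseteq> convex hull {p, q, s}" "area (convex hull {p, q, s}) \<le> (1 + 30 * x) * area K"
      using st(2) by blast
    have "delta_vol K T \<le> 2 * (area (convex hull {p, q, s}) / area K - 1)"
      unfolding tri(4) by (rule delta_vol_le_triangle[OF assms(1) hull(1) equilateral_isoperimetric_ratio(1)[OF tri(1-3)]])
    also have "\<dots> \<le> 2 * ((1 + 30 * x) - 1)"
    proof -
      have "area (convex hull {p, q, s}) / area K \<le> 1 + 30 * x"
        unfolding pos_divide_le_eq[OF aK] by (rule hull(2))
      then show ?thesis by (intro mult_left_mono diff_right_mono) simp_all
    qed
    also have "\<dots> < \<epsilon>" using x(3) st(1) by (simp add: x_def)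
    finally show False using assms(6) by simp
  qed
  have "perimeter K \<le> 2 * area K / r"
    using j by (intro inradius_perimeter_le assms(1) r) (auto simp: is_john_ellipsoid_def)
  then have "(perimeter K)\<^sup>2 \<le> (2 * area K / r)\<^sup>2" using perimeter_nonneg[OF assms(1)] by (intro power_mono)
  then have "(perimeter K)\<^sup>2 / area K \<le> (2 * area K / r)\<^sup>2 / area K" using aK by (intro divide_right_mono) auto
  also have "\<dots> = 4 * area K / r\<^sup>2" using aK by (simp add: power2_eq_square field_simps)
  also have "\<dots> \<le> (1 - x) * (12 * sqrt 3)" using small r by (simp add: pos_divide_le_eq)
  also have "\<dots> \<le> (1 - x) * ((perimeter T)\<^sup>2 / area T)"
    unfolding tri(4) using x by (intro mult_left_mono equilateral_isoperimetric_ratio(2) tri) auto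
  finally show ?thesis by (simp only: x_def)
qed

end
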